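(* Let $G$ be a nilpotent subgroup of $\mathrm{Homeo}(\mathbb{T}^2)$ and suppose that $[G]$ has one of the following forms: $[G]=\{\mathrm{Id}\}$; $[G]=\langle D\rangle$ where $D$ is a non-trivial Dehn twist; $[G]=\langle A\rangle$ or $[G]=\langle A,-\mathrm{Id}\rangle$ where $\mathrm{spec}(A)$ does not contain any eigenvalue of modulus $1$. Given $\phi\in G_0$ and $\mu\in\mathcal{P}(\phi)$, there exists $\nu\in\mathcal{P}(G)$ such that $\rho_\mu(\tilde\phi)=\rho_\nu(\tilde\phi)$ for any lift $\tilde\phi$ of $\phi$ and such that, moreover, if $\mu$ is $G_0$-invariant, then $\rho_\mu(\tilde\psi)=\rho_\nu(\tilde\psi)$ for any lift $\tilde\psi$ of every $\psi\in G_0$.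
   Context: $\mathbb{T}^2=\mathbb{R}^2/\mathbb{Z}^2$. For $\psi\in\mathrm{Homeo}(\mathbb{T}^2)$, $[\psi]\in\mathrm{MCG}(\mathbb{T}^2)=\mathrm{GL}(2,\mathbb{Z})$ is its mapping class (orientation-reversing classes are allowed), and $[G]=\{[\psi]:\psi\in G\}$. A non-trivial Dehn twist is a matrix conjugate in $\mathrm{GL}(2,\mathbb{Z})$ to $\begin{pmatrix}1&0\\ m&1\end{pmatrix}$ with $0\neq m\in\mathbb{Z}$. $G_0$ is the subgroup of elements of $G$ isotopic to the identity. $\mathcal{P}(\phi)$ is the set of $\phi$-invariant Borel probability measures on $\mathbb{T}^2$ and $\mathcal{P}(G)=\bigcap_{\psi\in G}\mathcal{P}(\psi)$. "Lift" means lift to the universal covering $\mathbb{R}^2$. For $\phi$ isotopic to the identity with lift $\tilde\phi$ and $\mu\in\mathcal{P}(\phi)$, $\rho_\mu(\tilde\phi):=\int_{\mathbb{T}^2}(\tilde\phi-\mathrm{Id})\,d\mu\in\mathbb{R}^2$ (note $\tilde\phi-\mathrm{Id}$ is well defined on $\mathbb{T}^2$). *)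

theory Defs
  imports "HOL-Probability.Probability" "HOL-Algebra.Algebra"
begin

definition torus_rel :: "real^2 \<Rightarrow> real^2 \<Rightarrow> bool" where
  "torus_rel x y \<longleftrightarrow> (\<forall>i. x $ i - y $ i \<in> \<int>)"

lemma equivp_torus_rel: "equivp torus_rel"
proof (rule equivpI)
  show "reflp torus_rel"
    by (auto simp: reflp_def torus_rel_def)
  show "symp torus_rel"
    unfolding symp_def torus_rel_def by (metis Ints_minus minus_diff_eq)
  show "transp torus_rel"
  proof (rule transpI)
    fix x y z assume "torus_rel x y" "torus_rel y z"
    then have "(x $ i - y $ i) + (y $ i - z $ i) \<in> \<int>" for i
      unfolding torus_rel_def by (intro Ints_add) auto
    then show "torus_rel x z" by (simp add: torus_rel_def)
  qed
qed

quotient_type torus = "real^2" / torus_rel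
  by (rule equivp_torus_rel)

definition torus_proj :: "real^2 \<Rightarrow> torus" where
  "torus_proj = abs_torus"

instantiation torus :: topological_space
begin

definition open_torus :: "torus set \<Rightarrow> bool" where
  "open_torus U \<longleftrightarrow> open (torus_proj -` U)"

instance
proof
  show "open (UNIV :: torus set)" by (simp add: open_torus_def)
next
  fix S T :: "torus set" assume "open S" "open T"
  then show "open (S \<inter> T)" by (auto simp: open_torus_def vimage_Int)
next
  fix K :: "torus set set" assume "\<forall>S\<in>K. open S"
  then show "open (\<Union>K)" by (auto simp: open_torus_def vimage_Union)
qed

end

definition is_homeo :: "(torus \<Rightarrow> torus) \<Rightarrow> bool" where
  "is_homeo f \<longleftrightarrow> (\<exists>g. homeomorphism UNIV UNIV f g)"

definition Homeo_torus :: "(torus \<Rightarrow> torus) monoid" where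
  "Homeo_torus = \<lparr>carrier = {f. is_homeo f}, mult = (\<circ>), one = id\<rparr>"

definition isotopic :: "(torus \<Rightarrow> torus) \<Rightarrow> (torus \<Rightarrow> torus) \<Rightarrow> bool" where
  "isotopic f g \<longleftrightarrow> homotopic_with_canon is_homeo UNIV UNIV f g"

definition isotopic_id_part :: "(torus \<Rightarrow> torus) set \<Rightarrow> (torus \<Rightarrow> torus) set" where
  "isotopic_id_part G = {\<psi> \<in> G. isotopic \<psi> id}"

definition is_lift :: "(real^2 \<Rightarrow> real^2) \<Rightarrow> (torus \<Rightarrow> torus) \<Rightarrow> bool" where
  "is_lift F f \<longleftrightarrow> continuous_on UNIV F \<and> (\<forall>x. torus_proj (F x) = f (torus_proj x))"

definition GL2Z :: "(int^2^2) monoid" where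
  "GL2Z = \<lparr>carrier = {A. invertible A}, mult = (**), one = mat 1\<rparr>"

definition int_vec :: "int^2 \<Rightarrow> real^2" where
  "int_vec v = (\<chi> i. real_of_int (v $ i))"

text \<open>The identification of the mapping class group of the torus with
  \<open>GL(2,\<int>)\<close> is the action on the fundamental group \<open>\<int>\<^sup>2\<close>, regarded as the
  group of deck transformations: a lift \<open>F\<close> of \<open>f\<close> satisfies
  \<open>F (x + v) = F x + A v\<close> for all integer vectors \<open>v\<close>, and \<open>A\<close> is the same for
  all lifts, since any two lifts differ by an integer translation.\<close>

definition mapping_class :: "(torus \<Rightarrow> torus) \<Rightarrow> int^2^2" where
  "mapping_class f =
     (THE A. \<exists>F. is_lift F f \<and> (\<forall>x v. F (x + int_vec v) = F x + int_vec (A *v v)))"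

definition nontrivial_dehn_twist :: "int^2^2 \<Rightarrow> bool" where
  "nontrivial_dehn_twist D \<longleftrightarrow>
     (\<exists>P \<in> carrier GL2Z. \<exists>m. m \<noteq> 0 \<and>
        D = P \<otimes>\<^bsub>GL2Z\<^esub> vector [vector [1, 0], vector [m, 1]] \<otimes>\<^bsub>GL2Z\<^esub> inv\<^bsub>GL2Z\<^esub> P)"

definition spec :: "int^2^2 \<Rightarrow> complex set" where
  "spec A = {c. \<exists>w :: complex^2. w \<noteq> 0 \<and> map_matrix of_int A *v w = c *s w}"

text \<open>With \<open>lower_central G 0 = G\<close>, each further term is the commutator subgroup of the
  previous one with \<open>G\<close>.\<close>

primrec lower_central :: "('a, 'b) monoid_scheme \<Rightarrow> nat \<Rightarrow> 'a set" where
  "lower_central G 0 = carrier G"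
| "lower_central G (Suc n) =
     generate G (\<Union>h \<in> lower_central G n. \<Union>g \<in> carrier G.
       {h \<otimes>\<^bsub>G\<^esub> g \<otimes>\<^bsub>G\<^esub> inv\<^bsub>G\<^esub> h \<otimes>\<^bsub>G\<^esub> inv\<^bsub>G\<^esub> g})"

definition nilpotent_group :: "('a, 'b) monoid_scheme \<Rightarrow> bool" where
  "nilpotent_group G \<longleftrightarrow> group G \<and> (\<exists>n. lower_central G n = {\<one>\<^bsub>G\<^esub>})"

definition inv_prob :: "(torus \<Rightarrow> torus) \<Rightarrow> torus measure set" where
  "inv_prob f = {\<mu>. prob_space \<mu> \<and> sets \<mu> = sets borel \<and> distr \<mu> borel f = \<mu>}"

definition inv_prob_group :: "(torus \<Rightarrow> torus) set \<Rightarrow> torus measure set" where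
  "inv_prob_group G = (\<Inter>\<psi>\<in>G. inv_prob \<psi>)"

text \<open>For a lift \<open>F\<close> of a homeomorphism isotopic to the identity, \<open>F - Id\<close> is
  \<open>\<int>\<^sup>2\<close>-periodic, so the choice of the representative \<open>rep_torus p\<close> of \<open>p\<close> is irrelevant.\<close>

definition rotation_vector :: "torus measure \<Rightarrow> (real^2 \<Rightarrow> real^2) \<Rightarrow> real^2" where
  "rotation_vector \<mu> F = (LINT p|\<mu>. F (rep_torus p) - rep_torus p)"

lemma group_Homeo_torus: "group Homeo_torus"
proof (rule groupI)
  fix f g assume "f \<in> carrier Homeo_torus" "g \<in> carrier Homeo_torus"
  then show "f \<otimes>\<^bsub>Homeo_torus\<^esub> g \<in> carrier Homeo_torus"
    by (auto simp: Homeo_torus_def is_homeo_def intro: homeomorphism_compose)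
next
  show "\<one>\<^bsub>Homeo_torus\<^esub> \<in> carrier Homeo_torus"
    using homeomorphism_ident[of "UNIV :: torus set"]
    by (auto simp: Homeo_torus_def is_homeo_def id_def)
next
  fix f assume "f \<in> carrier Homeo_torus"
  then obtain g where "homeomorphism UNIV UNIV f g"
    by (auto simp: Homeo_torus_def is_homeo_def)
  then have "homeomorphism UNIV UNIV g f" "g \<circ> f = id"
    by (auto simp: homeomorphism_def)
  then show "\<exists>g\<in>carrier Homeo_torus. g \<otimes>\<^bsub>Homeo_torus\<^esub> f = \<one>\<^bsub>Homeo_torus\<^esub>"
    by (auto simp: Homeo_torus_def is_homeo_def)
qed (auto simp: Homeo_torus_def)

lemma group_GL2Z: "group GL2Z"
proof (rule groupI)
  fix A B assume "A \<in> carrier GL2Z" "B \<in> carrier GL2Z"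
  then show "A \<otimes>\<^bsub>GL2Z\<^esub> B \<in> carrier GL2Z"
    by (simp add: GL2Z_def invertible_mult)
next
  fix A assume "A \<in> carrier GL2Z"
  then show "\<exists>B\<in>carrier GL2Z. B \<otimes>\<^bsub>GL2Z\<^esub> A = \<one>\<^bsub>GL2Z\<^esub>"
    by (auto simp: GL2Z_def invertible_def)
qed (auto simp: GL2Z_def matrix_mul_assoc invertible_def)

end

(* Rotation vectors restricted to measures invariant under a normal piece of G are homomorphisms on
   lifts. Starting from the phi-invariant measure, one climbs the lower central series
   G = Gamma 0 > Gamma 1 > ... > Gamma n = 1 backwards: Gamma i acts by commuting maps on the
   measures invariant under Gamma (i + 1), so a Markov-Kakutani argument yields invariant measures,
   provided the push-forward by z in Gamma i keeps the prescribed rotation vectors. It does when the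
   mapping class A of z is unipotent: by induction along the series, the rotation vectors x m of the
   measures z^m nu satisfy x (m + 1) = A x m + b, and a bounded solution of this is constant.
   For hyperbolic A the same recursion, now for the difference of two measures and without b, has
   only the zero bounded two-sided solution, so all measures invariant under the elements of trivial
   class have the same rotation vectors and no care is needed beyond these elements.

   Elements of trivial mapping class are used throughout in place of elements isotopic to the
   identity, so only the easy implication between the two notions matters. *)

theory Submission
  imports Defs
begin

section \<open>Lifts and mapping classes\<close>

text \<open>The given measure is invariant only under a set \<open>H\<close>
  (\<open>{\<phi>}\<close> or \<open>G_0\<close>) that need not be one of the terms climbed through.
  The climb nevertheless keeps \<open>H\<close>-invariance: an element of \<open>H\<close> commutes
  with \<open>z\<close> in \<open>\<Gamma> i\<close> up to an element of
  \<open>\<Gamma> (i + 1)\<close>, which fixes the measures at hand, so push-forward by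
  \<open>z\<close> respects it.

  The constant \<open>b\<close> comes from a commutator. For \<open>\<psi>\<close> in
  \<open>\<Gamma> j\<close> of trivial class, \<open>z^-1 \<psi> z = \<kappa> \<psi>\<close> with
  \<open>\<kappa>\<close> both in \<open>\<Gamma> (i + 1)\<close> and in
  \<open>\<Gamma> (j + 1)\<close>. The first membership makes the measures
  \<open>\<kappa>\<close>-invariant, so that rotation vectors add; the second lets the induction fix
  the contribution of \<open>\<kappa>\<close> along the orbit.

  Everything asked of a measure, invariance as well as prescribed rotation vectors, is an equation
  \<open>\<integral> f = c\<close> with \<open>f\<close> continuous. Solution sets of such systems
  survive averaging and weak limits. Weak compactness on the torus is taken from the real line,
  through a continuous curve onto the torus that has a bounded Borel section.\<close>

lemma torus_proj_eq_iff: "torus_proj x = torus_proj y \<longleftrightarrow> (\<forall>i. x $ i - y $ i \<in> \<int>)"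
  unfolding torus_proj_def torus.abs_eq_iff torus_rel_def by simp

lemma torus_proj_rep [simp]: "torus_proj (rep_torus p) = p"
  unfolding torus_proj_def by (rule Quotient_abs_rep[OF Quotient_torus])

lemma torus_proj_eq_imp_int_vec:
  assumes "torus_proj x = torus_proj y"
  obtains v where "x = y + int_vec v"
proof -
  have "\<forall>i. \<exists>k. x $ i - y $ i = real_of_int k"
    using assms by (auto simp: torus_proj_eq_iff elim: Ints_cases)
  then obtain k where k: "\<And>i. x $ i - y $ i = real_of_int (k i)" by metis
  have "x = y + int_vec (\<chi> i. k i)"
    by (simp add: vec_eq_iff int_vec_def flip: k)
  then show ?thesis by (rule that)
qed

lemma torus_proj_add_int_vec [simp]: "torus_proj (x + int_vec v) = torus_proj x"
  by (simp add: torus_proj_eq_iff int_vec_def)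

lemma int_vec_add: "int_vec (v + w) = int_vec v + int_vec w"
  by (simp add: int_vec_def vec_eq_iff)

lemma int_vec_minus: "int_vec (- v) = - int_vec v"
  by (simp add: int_vec_def vec_eq_iff)

lemma int_vec_inject [simp]: "int_vec v = int_vec w \<longleftrightarrow> v = w"
  by (simp add: int_vec_def vec_eq_iff)

lemma continuous_on_torus_proj: "continuous_on S torus_proj"
proof -
  have "continuous_on UNIV torus_proj"
    by (simp add: continuous_on_open_vimage open_torus_def)
  then show ?thesis by (rule continuous_on_subset) simp
qed

lemma continuous_on_torus_iff:
  "continuous_on UNIV f \<longleftrightarrow> continuous_on UNIV (\<lambda>x. f (torus_proj x))"
proof -
  have "(\<lambda>x. f (torus_proj x)) -` S = torus_proj -` (f -` S)" for S by auto
  then show ?thesis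
    by (simp add: continuous_on_open_vimage open_torus_def)
qed

text \<open>\<open>rep_torus\<close> is an arbitrary, discontinuous choice; periodicity makes the
  composite independent of it, and the quotient topology then gives continuity.\<close>

lemma continuous_on_periodic_torus:
  assumes q: "continuous_on UNIV q" and per: "\<And>x v. q (x + int_vec v) = q x"
  shows "continuous_on UNIV (\<lambda>p. q (rep_torus p))"
proof -
  have "q (rep_torus (torus_proj x)) = q x" for x
    by (metis per torus_proj_eq_imp_int_vec torus_proj_rep)
  then show ?thesis using q by (simp add: continuous_on_torus_iff)
qed

lemma periodic_rep_torus_proj:
  assumes "\<And>x v. q (x + int_vec v) = q x"
  shows "q (rep_torus (torus_proj x)) = q x"
  by (metis assms torus_proj_eq_imp_int_vec torus_proj_rep)

lemma compact_UNIV_torus: "compact (UNIV :: torus set)"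
proof -
  have "torus_proj ` cbox 0 1 = UNIV"
  proof (intro equalityI subset_UNIV subsetI)
    fix p :: torus
    define x where "x = rep_torus p"
    define y :: "real^2" where "y = (\<chi> i. frac (x $ i))"
    have "torus_proj y = torus_proj x"
      by (simp add: torus_proj_eq_iff y_def frac_def)
    moreover have "y \<in> cbox 0 1"
      by (auto simp: mem_box_cart y_def frac_lt_1 less_imp_le)
    ultimately show "p \<in> torus_proj ` cbox 0 1"
      unfolding x_def by (metis image_eqI torus_proj_rep)
  qed
  then show ?thesis
    by (metis compact_cbox compact_continuous_image continuous_on_torus_proj)
qed

text \<open>Each coordinate of \<open>F - G\<close> is continuous and integer valued. Distinct
  integers are at least 1 apart, so it is constant on a connected set.\<close>

lemma continuous_integer_difference_const:
  fixes S :: "'a::topological_space set" and F G :: "'a \<Rightarrow> real^2"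
  assumes "connected S" "continuous_on S F" "continuous_on S G"
    and eq: "\<And>x. x \<in> S \<Longrightarrow> torus_proj (F x) = torus_proj (G x)"
  obtains w where "\<And>x. x \<in> S \<Longrightarrow> F x = G x + int_vec w"
proof (cases "S = {}")
  case True then show ?thesis using that by simp
next
  case False
  then obtain a where a: "a \<in> S" by auto
  obtain w where w: "F a = G a + int_vec w"
    using eq[OF a] torus_proj_eq_imp_int_vec by metis
  have "F x = G x + int_vec w" if x: "x \<in> S" for x
  proof -
    have "(F x - G x) $ i = (F a - G a) $ i" for i
    proof -
      have c: "continuous_on S (\<lambda>x. (F x - G x) $ i)"
        using assms by (intro continuous_intros)
      have "(\<lambda>x. (F x - G x) $ i) constant_on S"
      proof (rule continuous_discrete_range_constant[OF assms(1) c])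
        fix y assume y: "y \<in> S"
        have "1 \<le> norm ((F z - G z) $ i - (F y - G y) $ i)"
          if z: "z \<in> S" "(F z - G z) $ i \<noteq> (F y - G y) $ i" for z
        proof -
          obtain k l where "(F z - G z) $ i = of_int k" "(F y - G y) $ i = of_int l"
            using eq[OF z(1)] eq[OF y] unfolding torus_proj_eq_iff
            by (metis Ints_cases vector_minus_component)
          with z show ?thesis by (simp flip: of_int_diff of_int_abs)
        qed
        then show "\<exists>e>0. \<forall>z. z \<in> S \<and> (F z - G z) $ i \<noteq> (F y - G y) $ i \<longrightarrow>
              e \<le> norm ((F z - G z) $ i - (F y - G y) $ i)"
          by (intro exI[of _ 1]) auto
      qed
      then show ?thesis using a x by (auto simp: constant_on_def)
    qed
    then have "F x - G x = F a - G a" by (simp add: vec_eq_iff)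
    then show ?thesis by (simp add: w algebra_simps)
  qed
  then show ?thesis by (rule that)
qed

text \<open>The circle coordinates \<open>exp (2 pi i x_j)\<close> descend to the torus. Composed
  with \<open>f\<close> they are nowhere zero, hence have continuous logarithms on a contractible
  set; the imaginary parts divided by \<open>2 pi\<close> are the coordinates of the lift.\<close>

lemma lift_on_contractible:
  fixes S :: "'a::real_normed_vector set" and f :: "'a \<Rightarrow> torus"
  assumes "contractible S" "continuous_on S f"
  obtains F where "continuous_on S F" "\<And>x. x \<in> S \<Longrightarrow> torus_proj (F x) = f x"
proof -
  define e where "e = (\<lambda>i::2. \<lambda>x :: real^2. exp (\<i> * (2 * pi * x $ i)))"
  have per: "e i (x + int_vec v) = e i x" for i x v
  proof -
    have "e i (x + int_vec v) = e i x * exp (2 * pi * (v $ i) * \<i>)"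
      by (simp add: e_def int_vec_def algebra_simps flip: exp_add)
    also have "exp (2 * pi * (v $ i) * \<i>) = 1"
      using exp_integer_2pi[of "of_int (v $ i)"] by (simp add: ac_simps)
    finally show ?thesis by simp
  qed
  have ce: "continuous_on UNIV (\<lambda>p. e i (rep_torus p))" for i
    by (rule continuous_on_periodic_torus[OF _ per]) (auto simp: e_def intro!: continuous_intros)
  have cf: "continuous_on S (\<lambda>x. e i (rep_torus (f x)))" for i
    using continuous_on_compose2[OF ce assms(2)] by auto
  have "\<exists>g. continuous_on S g \<and> (\<forall>x\<in>S. e i (rep_torus (f x)) = exp (g x))" for i
  proof -
    have nz: "e i (rep_torus (f x)) \<noteq> 0" for x by (simp add: e_def)
    obtain g where "continuous_on S g" "\<And>x. x \<in> S \<Longrightarrow> e i (rep_torus (f x)) = exp (g x)"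
      using continuous_logarithm_on_contractible[OF cf[of i] assms(1) nz] by blast
    then show ?thesis by auto
  qed
  then obtain g where g: "\<And>i. continuous_on S (g i)"
      "\<And>i x. x \<in> S \<Longrightarrow> e i (rep_torus (f x)) = exp (g i x)" by metis
  define F :: "'a \<Rightarrow> real^2" where "F = (\<lambda>x. \<chi> i. Im (g i x) / (2 * pi))"
  have "continuous_on S F"
    unfolding F_def using g(1) by (intro continuous_intros) auto
  moreover have "torus_proj (F x) = f x" if x: "x \<in> S" for x
  proof -
    have "F x $ i - rep_torus (f x) $ i \<in> \<int>" for i
    proof -
      define r where "r = rep_torus (f x) $ i"
      have "exp (\<i> * (2 * pi * r)) = exp (g i x)"
        using g(2)[OF x, of i] by (simp add: e_def r_def)
      then obtain n :: int where "\<i> * (2 * pi * r) = g i x + (of_int (2 * n) * pi) * \<i>"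
        unfolding exp_eq by blast
      from arg_cong[OF this, of Im] have "2 * pi * r = Im (g i x) + 2 * n * pi"
        by simp
      then have "F x $ i - r = - of_int n"
        by (simp add: F_def field_simps)
      then show ?thesis by (simp add: r_def)
    qed
    then have "torus_proj (F x) = torus_proj (rep_torus (f x))"
      unfolding torus_proj_eq_iff by blast
    then show ?thesis by simp
  qed
  ultimately show ?thesis by (rule that)
qed

abbreviation (input) real_mat :: "int^2^2 \<Rightarrow> real^2^2" where
  "real_mat A \<equiv> map_matrix real_of_int A"

lemma int_vec_matrix_mult: "int_vec (A *v v) = real_mat A *v int_vec v"
  by (simp add: int_vec_def vec_eq_iff matrix_vector_mult_def)

lemma additive_int_vec_matrix:
  fixes c :: "int^2 \<Rightarrow> int^2"
  assumes add: "\<And>v w. c (v + w) = c v + c w"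
  obtains A where "\<And>v. c v = A *v v"
proof -
  have c0: "c 0 = 0" using add[of 0 0] by simp
  have cm: "c (- v) = - c v" for v using add[of v "-v"] c0 by (simp add: eq_neg_iff_add_eq_0 add.commute)
  have cn: "c (int n *s v) = int n *s c v" for n v
    by (induction n) (auto simp: c0 add vec.scale_left_distrib)
  have cs: "c (k *s v) = k *s c v" for k v
  proof (cases "k \<ge> 0")
    case True then show ?thesis using cn[of "nat k" v] by simp
  next
    case False
    then have "c (- k *s v) = - (k *s c v)"
      using cn[of "nat (-k)" v] by (simp add: vec_eq_iff)
    moreover have "- k *s v = - (k *s v)" by (simp add: vec_eq_iff)
    ultimately show ?thesis by (simp add: cm)
  qed
  define A :: "int^2^2" where "A = (\<chi> i j. c (axis j 1) $ i)"
  have "c v = A *v v" for v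
  proof -
    have "v = v $ 1 *s axis 1 1 + v $ 2 *s axis 2 1"
      by (simp add: vec_eq_iff forall_2 axis_def)
    then have "c v = v $ 1 *s c (axis 1 1) + v $ 2 *s c (axis 2 1)"
      by (metis add cs)
    also have "\<dots> = A *v v"
      by (simp add: vec_eq_iff A_def matrix_vector_mult_def sum_2 mult.commute)
    finally show ?thesis .
  qed
  then show ?thesis by (rule that)
qed

text \<open>The relation under the \<open>THE\<close> of \<open>mapping_class\<close>, with the lift
  kept visible: classes then multiply simply because lifts compose.\<close>

definition is_lift_of_class :: "(real^2 \<Rightarrow> real^2) \<Rightarrow> (torus \<Rightarrow> torus) \<Rightarrow> int^2^2 \<Rightarrow> bool" where
  "is_lift_of_class F f A \<longleftrightarrow> is_lift F f \<and> (\<forall>x v. F (x + int_vec v) = F x + int_vec (A *v v))"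

lemma lift_unique:
  assumes "is_lift F f" "is_lift G f"
  obtains w where "\<And>x. F x = G x + int_vec w"
  using continuous_integer_difference_const[of UNIV F G] assms unfolding is_lift_def
  by (metis UNIV_I connected_UNIV)

lemma matrix_eqI: 
  fixes A B :: "'a::semiring_1^'n^'m"
  assumes "\<And>v. A *v v = B *v v" shows "A = B"
proof -
  have "A $ i $ j = B $ i $ j" for i j
    using arg_cong[OF assms[of "axis j 1"], of "\<lambda>w. w $ i"]
    by (simp add: matrix_vector_mult_def axis_def if_distrib cong: if_cong)
  then show ?thesis by (simp add: vec_eq_iff)
qed

lemma is_lift_of_class_unique:
  assumes F: "is_lift_of_class F f A" and G: "is_lift_of_class G f B"
  shows "A = B"
proof -
  obtain w where w: "\<And>x. F x = G x + int_vec w"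
    using lift_unique F G unfolding is_lift_of_class_def by blast
  have "int_vec (A *v v) = int_vec (B *v v)" for v
  proof -
    have "F (0 + int_vec v) = F 0 + int_vec (A *v v)" "G (0 + int_vec v) = G 0 + int_vec (B *v v)"
      using F G unfolding is_lift_of_class_def by blast+
    then show ?thesis by (simp add: w)
  qed
  then show ?thesis by (intro matrix_eqI) simp
qed

text \<open>\<open>F\<close> and its translate \<open>x \<mapsto> F (x + int_vec v)\<close> project
  to the same map, so they differ by a constant integer vector. That vector is additive in
  \<open>v\<close>, hence given by a matrix.\<close>

lemma lift_has_class:
  assumes "is_lift F f"
  obtains A where "is_lift_of_class F f A"
proof -
  have cF: "continuous_on UNIV F" using assms by (simp add: is_lift_def)
  have "\<exists>w. \<forall>x. F (x + int_vec v) = F x + int_vec w" for v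
  proof -
    have c1: "continuous_on UNIV (\<lambda>x. F (x + int_vec v))"
      by (rule continuous_on_compose2[OF cF]) (auto intro!: continuous_intros)
    have "torus_proj (F (x + int_vec v)) = torus_proj (F x)" for x
      using assms by (simp add: is_lift_def)
    then show ?thesis
      using continuous_integer_difference_const[of UNIV "\<lambda>x. F (x + int_vec v)" F] c1 cF
      by (metis UNIV_I connected_UNIV)
  qed
  then obtain c where c: "\<And>v x. F (x + int_vec v) = F x + int_vec (c v)" by metis
  have "c (v + w) = c v + c w" for v w
  proof -
    have "F (0 + int_vec (v + w)) = F 0 + int_vec (c v) + int_vec (c w)"
      by (simp add: int_vec_add c flip: add.assoc) (metis add_0 c)
    then have "int_vec (c (v + w)) = int_vec (c v + c w)"
      unfolding c by (simp add: int_vec_add)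
    then show ?thesis by simp
  qed
  then obtain A where "\<And>v. c v = A *v v" using additive_int_vec_matrix by metis
  with c assms show ?thesis by (intro that[of A]) (auto simp: is_lift_of_class_def)
qed

lemma mapping_class_eqI:
  assumes "is_lift_of_class F f A" shows "mapping_class f = A"
  unfolding mapping_class_def using assms is_lift_of_class_unique
  by (intro the_equality) (auto simp: is_lift_of_class_def)

lemma lift_class: "is_lift F f \<Longrightarrow> is_lift_of_class F f (mapping_class f)"
  by (metis lift_has_class mapping_class_eqI)

lemma lift_exists:
  assumes "continuous_on UNIV f"
  obtains F where "is_lift F f"
proof -
  have "continuous_on UNIV (\<lambda>x. f (torus_proj x))"
    using assms by (simp add: continuous_on_torus_iff)
  then obtain F where "continuous_on UNIV F" "\<And>x. x \<in> UNIV \<Longrightarrow> torus_proj (F x) = f (torus_proj x)"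
    using lift_on_contractible[OF convex_imp_contractible[OF convex_UNIV]] by metis
  then show ?thesis by (intro that[of F]) (auto simp: is_lift_def)
qed

lemma is_lift_compose:
  assumes "is_lift F f" "is_lift G g" shows "is_lift (F \<circ> G) (f \<circ> g)"
  using assms unfolding is_lift_def
  by (auto intro: continuous_on_compose2[of UNIV F UNIV G])

lemma is_lift_id: "is_lift id id"
  by (simp add: is_lift_def id_def)

lemma is_lift_of_class_compose:
  assumes "is_lift_of_class F f A" "is_lift_of_class G g B"
  shows "is_lift_of_class (F \<circ> G) (f \<circ> g) (A ** B)"
  using assms unfolding is_lift_of_class_def
  by (auto intro: is_lift_compose simp: matrix_vector_mul_assoc)

lemma mapping_class_id: "mapping_class id = mat 1"
  by (rule mapping_class_eqI[of id]) (simp add: is_lift_of_class_def is_lift_id)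

lemma mapping_class_compose:
  assumes "continuous_on UNIV f" "continuous_on UNIV g"
  shows "mapping_class (f \<circ> g) = mapping_class f ** mapping_class g"
  by (metis assms is_lift_of_class_compose lift_class lift_exists mapping_class_eqI)

lemma is_homeo_continuous: "is_homeo f \<Longrightarrow> continuous_on UNIV f"
  by (auto simp: is_homeo_def homeomorphism_def)

text \<open>The whole isotopy is lifted over the contractible set \<open>[0,1] x R^2\<close>. The
  defect \<open>K (t, x + v) - K (t, x)\<close> is a constant integer vector there, and it can be
  read off at \<open>t = 1\<close>, where the slice lifts the identity.\<close>

lemma isotopic_id_mapping_class:
  assumes "isotopic f id" shows "mapping_class f = mat 1"
proof -
  obtain h :: "real \<times> torus \<Rightarrow> torus" where ch: "continuous_on ({0..1} \<times> UNIV) h"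
    and h: "\<And>x. h (0, x) = f x" "\<And>x. h (1, x) = id x"
    using assms unfolding isotopic_def homotopic_with_def 
    by (auto simp: prod_topology_subtopology_eu simp flip: subtopology_UNIV)
  have ch': "continuous_on ({0..1} \<times> UNIV) (\<lambda>z :: real \<times> (real^2). h (fst z, torus_proj (snd z)))"
    by (rule continuous_on_compose2[OF ch])
      (auto intro!: continuous_intros continuous_on_compose2[OF continuous_on_torus_proj])
  have "contractible ({0..1::real} \<times> (UNIV :: (real^2) set))"
    by (intro convex_imp_contractible convex_Times) auto
  from lift_on_contractible[OF this ch'] obtain K where cK: "continuous_on ({0..1} \<times> UNIV) K"
    and K: "\<And>z. z \<in> {0..1} \<times> UNIV \<Longrightarrow> torus_proj (K z) = h (fst z, torus_proj (snd z))"
    by blast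
  have slice: "continuous_on UNIV (\<lambda>x. K (t, x))" if "t \<in> {0..1}" for t
    by (rule continuous_on_compose2[OF cK]) (use that in \<open>auto intro!: continuous_intros\<close>)
  have l0: "is_lift (\<lambda>x. K (0, x)) f" and l1: "is_lift (\<lambda>x. K (1, x)) id"
    using slice K by (auto simp: is_lift_def h)
  have "K (0, x + int_vec v) = K (0, x) + int_vec v" for x v
  proof -
    have c: "connected ({0..1::real} \<times> (UNIV :: (real^2) set))"
      by (intro connected_Times) auto
    have c1: "continuous_on ({0..1} \<times> UNIV) (\<lambda>z. K (fst z, snd z + int_vec v))"
      by (rule continuous_on_compose2[OF cK]) (auto intro!: continuous_intros)
    have d: "torus_proj (K (fst z, snd z + int_vec v)) = torus_proj (K z)" if "z \<in> {0..1} \<times> UNIV" for z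
      using K that by auto
    obtain w where w: "\<And>z. z \<in> {0..1} \<times> UNIV \<Longrightarrow> K (fst z, snd z + int_vec v) = K z + int_vec w"
      using continuous_integer_difference_const[OF c c1 cK d] by blast
    have "K (1, 0 + int_vec v) = K (1, 0) + int_vec v"
      using lift_class[OF l1] unfolding is_lift_of_class_def mapping_class_id
        matrix_vector_mul_lid by blast
    then have "int_vec w = int_vec v" using w[of "(1, 0)"] by simp
    then show ?thesis using w[of "(0, x)"] by simp
  qed
  then have "is_lift_of_class (\<lambda>x. K (0, x)) f (mat 1)"
    using l0 by (simp add: is_lift_of_class_def)
  then show ?thesis by (rule mapping_class_eqI)
qed

section \<open>A space-filling curve of the torus\<close>

text \<open>For \<open>a\<close> with values 0 and 1 this is the point of the Cantor middle-third
  set whose ternary digits are \<open>2 * a k\<close>.\<close>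

definition cantor_sum :: "(nat \<Rightarrow> real) \<Rightarrow> real" where
  "cantor_sum a = suminf (\<lambda>k. 2 * a k / 3 ^ Suc k)"

lemma cantor_sum_summable:
  assumes "\<And>k. a k \<in> {0..1::real}" shows "summable (\<lambda>k. 2 * a k / 3 ^ Suc k)"
proof (rule summable_comparison_test')
  show "summable (\<lambda>k. 2 / 3 * (1/3::real) ^ k)" by (intro summable_mult summable_geometric) simp
  show "norm (2 * a n / 3 ^ Suc n) \<le> 2 / 3 * (1/3) ^ n" for n
    using assms[of n] by (simp add: power_divide divide_simps)
qed

lemma cantor_sum_bounds:
  assumes "\<And>k. a k \<in> {0..1::real}" shows "cantor_sum a \<in> {0..1}"
proof -
  have "cantor_sum a \<le> suminf (\<lambda>k. 2 / 3 * (1/3::real) ^ k)"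
    unfolding cantor_sum_def
  proof (rule suminf_le[OF _ cantor_sum_summable[OF assms]])
    show "2 * a n / 3 ^ Suc n \<le> 2 / 3 * (1/3) ^ n" for n
      using assms[of n] by (simp add: power_divide divide_simps)
    show "summable (\<lambda>k. 2 / 3 * (1/3::real) ^ k)" by (intro summable_mult summable_geometric) simp
  qed
  also have "\<dots> = 1" by (subst suminf_mult) (auto simp: suminf_geometric)
  finally have "cantor_sum a \<le> 1" .
  moreover have "0 \<le> cantor_sum a"
    unfolding cantor_sum_def by (rule suminf_nonneg[OF cantor_sum_summable[OF assms]]) (use assms in auto)
  ultimately show ?thesis by simp
qed

lemma cantor_sum_shift:
  assumes "\<And>k. a k \<in> {0..1::real}"
  shows "3 * cantor_sum a = 2 * a 0 + cantor_sum (\<lambda>k. a (Suc k))"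
proof -
  have "cantor_sum a = suminf (\<lambda>k. 2 * a (Suc k) / 3 ^ Suc (Suc k)) + 2 * a 0 / 3"
    unfolding cantor_sum_def by (subst suminf_split_head[OF cantor_sum_summable[OF assms]]) simp
  also have "suminf (\<lambda>k. 2 * a (Suc k) / 3 ^ Suc (Suc k)) = suminf (\<lambda>k. 2 * a (Suc k) / 3 ^ Suc k / 3)"
    by (intro arg_cong[of _ _ suminf]) auto
  also have "\<dots> = cantor_sum (\<lambda>k. a (Suc k)) / 3"
    unfolding cantor_sum_def by (rule suminf_divide) (rule cantor_sum_summable, rule assms)
  finally show ?thesis by simp
qed

text \<open>Multiplication by \<open>3 ^ k\<close> moves the first \<open>k\<close> digits before
  the point. As these digits are 0 or 2, the integer split off is even, which a function of period 2
  such as \<open>plateau\<close> ignores.\<close>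

lemma cantor_sum_power_shift:
  assumes "\<And>k. a k \<in> {0, 1::real}"
  shows "\<exists>n::nat. 3 ^ k * cantor_sum a = 2 * real n + cantor_sum (\<lambda>j. a (k + j))"
proof (induction k)
  case 0 then show ?case by (auto intro: exI[of _ 0])
next
  case (Suc k)
  then obtain n where n: "3 ^ k * cantor_sum a = 2 * real n + cantor_sum (\<lambda>j. a (k + j))" by blast
  have "a (k + j) \<in> {0..1}" for j using assms[of "k + j"] by auto
  from cantor_sum_shift[of "\<lambda>j. a (k + j)", OF this]
  have "3 ^ Suc k * cantor_sum a = 2 * (3 * real n + a k) + cantor_sum (\<lambda>j. a (Suc k + j))"
    using n by (simp add: algebra_simps)
  moreover have "\<exists>m::nat. a k = real m" using assms[of k] by (auto intro: exI[of _ 0] exI[of _ 1])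
  then obtain m :: nat where "a k = real m" by blast
  ultimately show ?case by (intro exI[of _ "3 * n + m"]) simp
qed

text \<open>An even function of period 2 that is 0 on \<open>[0, 1/3]\<close> and 1 on
  \<open>[2/3, 1]\<close>; these plateaus arise by clipping because
  \<open>cos (pi / 3) = 1/2\<close> and \<open>cos (2 * pi / 3) = -1/2\<close>.\<close>

definition plateau :: "real \<Rightarrow> real" where
  "plateau t = min 1 (max 0 (1/2 - cos (pi * t)))"

text \<open>Modulo 2 the argument is the Cantor point \<open>\<tau>\<close> with leading digit
  \<open>2 * a k\<close>. It lies in the first or in the last third of the unit interval according
  to \<open>a k\<close>, that is, on the matching plateau.\<close>

lemma plateau_cantor_sum:
  assumes "\<And>k. a k \<in> {0, 1::real}"
  shows "plateau (3 ^ k * cantor_sum a) = a k"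
proof -
  define \<tau> where "\<tau> = cantor_sum (\<lambda>j. a (k + j))"
  have a: "a j \<in> {0..1}" for j using assms[of j] by auto
  obtain n :: nat where "3 ^ k * cantor_sum a = 2 * real n + \<tau>"
    using cantor_sum_power_shift[of a k, OF assms] unfolding \<tau>_def by blast
  then have "pi * (3 ^ k * cantor_sum a) = pi * \<tau> + 2 * real n * pi"
    by (simp add: algebra_simps)
  then have "cos (pi * (3 ^ k * cantor_sum a)) = cos (pi * \<tau>)"
    by (simp add: cos_add)
  moreover have shift: "3 * \<tau> = 2 * a k + cantor_sum (\<lambda>j. a (Suc (k + j)))"
    unfolding \<tau>_def using cantor_sum_shift[of "\<lambda>j. a (k + j)"] a by simp
  moreover have r: "cantor_sum (\<lambda>j. a (Suc (k + j))) \<in> {0..1}" by (intro cantor_sum_bounds a)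
  moreover have "cos (pi * \<tau>) \<ge> 1/2" if "a k = 0"
  proof -
    have "0 \<le> \<tau>" "\<tau> \<le> 1/3" using shift r that by auto
    then have "cos (pi / 3) \<le> cos (pi * \<tau>)" by (intro cos_monotone_0_pi_le) auto
    then show ?thesis by (simp add: cos_60)
  qed
  moreover have "cos (pi * \<tau>) \<le> -1/2" if "a k = 1"
  proof -
    have "2/3 \<le> \<tau>" "\<tau> \<le> 1" using shift r that by auto
    then have "cos (pi * \<tau>) \<le> cos (pi * (2/3))" by (intro cos_monotone_0_pi_le) auto
    also have "\<dots> = - cos (pi / 3)" by (subst cos_pi_minus[symmetric]) (simp add: field_simps)
    finally show ?thesis by (simp add: cos_60)
  qed
  ultimately show ?thesis using assms[of k] by (auto simp: plateau_def)
qed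

definition binary_digit :: "real \<Rightarrow> nat \<Rightarrow> real" where
  "binary_digit x k = real_of_int (\<lfloor>2 ^ Suc k * x\<rfloor> - 2 * \<lfloor>2 ^ k * x\<rfloor>)"

lemma binary_digit_range: "binary_digit x k \<in> {0, 1}"
proof -
  have "\<lfloor>2 * (2 ^ k * x)\<rfloor> - 2 * \<lfloor>2 ^ k * x\<rfloor> \<in> {0, 1}"
    using floor_correct[of "2 * (2 ^ k * x)"] floor_correct[of "2 ^ k * x"] by auto linarith
  then show ?thesis unfolding binary_digit_def by (auto simp: mult.assoc)
qed

lemma binary_digit_sums:
  assumes "0 \<le> x" "x < 1"
  shows "(\<lambda>k. binary_digit x k / 2 ^ Suc k) sums x"
proof -
  \<comment> \<open>The truncation of \<open>x\<close> to \<open>n\<close> binary places; it is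
    within \<open>(1/2) ^ n\<close> of \<open>x\<close>, and its increments are the terms of the
    series.\<close>
  define D where "D = (\<lambda>n. real_of_int \<lfloor>2 ^ n * x\<rfloor> / 2 ^ n)"
  have "D \<longlonglongrightarrow> x"
  proof (rule tendsto_sandwich)
    show "\<forall>\<^sub>F n in sequentially. x - (1/2) ^ n \<le> D n"
    proof (intro always_eventually allI)
      fix n
      have "2 ^ n * x - 1 \<le> \<lfloor>2 ^ n * x\<rfloor>" by linarith
      then have "(2 ^ n * x - 1) / 2 ^ n \<le> D n" unfolding D_def by (intro divide_right_mono) auto
      then show "x - (1/2) ^ n \<le> D n" by (simp add: diff_divide_distrib power_divide)
    qed
    show "\<forall>\<^sub>F n in sequentially. D n \<le> x"
    proof (intro always_eventually allI)
      fix n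
      have "\<lfloor>2 ^ n * x\<rfloor> \<le> 2 ^ n * x" by linarith
      then show "D n \<le> x" by (simp add: D_def field_simps)
    qed
    have "(\<lambda>n. x - (1/2) ^ n) \<longlonglongrightarrow> x - 0"
      by (intro tendsto_intros LIMSEQ_power_zero) auto
    then show "(\<lambda>n. x - (1/2) ^ n) \<longlonglongrightarrow> x" by simp
  qed auto
  then have "(\<lambda>k. D (Suc k) - D k) sums (x - D 0)" by (rule telescope_sums)
  moreover have "D 0 = 0" using assms by (simp add: D_def floor_eq_iff)
  moreover have "D (Suc k) - D k = binary_digit x k / 2 ^ Suc k" for k
    by (simp add: D_def binary_digit_def field_simps)
  ultimately show ?thesis by simp
qed

text \<open>Schoenberg's space-filling curve: coordinate 0 reads the ternary digits of
  \<open>t\<close> in even positions, coordinate 1 those in odd positions, and both reinterpret them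
  as binary digits.\<close>

definition schoenberg :: "nat \<Rightarrow> real \<Rightarrow> real" where
  "schoenberg i t = suminf (\<lambda>k. plateau (3 ^ (2 * k + i) * t) / 2 ^ Suc k)"

lemma continuous_on_schoenberg: "continuous_on UNIV (schoenberg i)"
proof -
  have "uniform_limit UNIV (\<lambda>n t. \<Sum>k<n. plateau (3 ^ (2 * k + i) * t) / 2 ^ Suc k) (schoenberg i) sequentially"
    unfolding schoenberg_def
  proof (rule Weierstrass_m_test)
    show "norm (plateau (3 ^ (2 * n + i) * t) / 2 ^ Suc n) \<le> (1/2) ^ Suc n" for n t
      by (simp add: plateau_def power_divide divide_right_mono)
    show "summable (\<lambda>n. (1/2::real) ^ Suc n)" by (simp add: summable_geometric summable_mult)
  qed
  moreover have "continuous_on UNIV (\<lambda>t. \<Sum>k<n. plateau (3 ^ (2 * k + i) * t) / 2 ^ Suc k)" for n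
    unfolding plateau_def by (intro continuous_intros) auto
  ultimately show ?thesis
    by (intro uniform_limit_theorem[where F = sequentially]) auto
qed

text \<open>A right inverse of the curve on \<open>[0,1) x [0,1)\<close>: the binary digits of
  \<open>x\<close> and \<open>y\<close> are interleaved as Cantor digits. Being built from floors
  and a series, it is Borel although not continuous.\<close>

definition schoenberg_section :: "real \<Rightarrow> real \<Rightarrow> real" where
  "schoenberg_section x y =
     cantor_sum (\<lambda>n. binary_digit (if even n then x else y) (n div 2))"

lemma schoenberg_section:
  assumes "0 \<le> x" "x < 1" "0 \<le> y" "y < 1"
  shows "schoenberg 0 (schoenberg_section x y) = x" "schoenberg 1 (schoenberg_section x y) = y"
proof -
  have "plateau (3 ^ (2 * k) * schoenberg_section x y) = binary_digit x k"
    and "plateau (3 ^ (2 * k + 1) * schoenberg_section x y) = binary_digit y k" for k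
    unfolding schoenberg_section_def by (subst plateau_cantor_sum; simp add: binary_digit_range del: insert_iff)+
  then show "schoenberg 0 (schoenberg_section x y) = x" "schoenberg 1 (schoenberg_section x y) = y"
    using binary_digit_sums assms unfolding schoenberg_def by (simp_all add: sums_iff)
qed

text \<open>\<open>frac\<close> removes the arbitrary choice in \<open>rep_torus\<close> and is
  lower semicontinuous: for \<open>c \<ge> 0\<close> the set where it exceeds \<open>c\<close> is
  the union of the open strips between \<open>n + c\<close> and \<open>n + 1\<close>.\<close>

lemma borel_measurable_torus_frac: "(\<lambda>p. frac (rep_torus p $ i)) \<in> borel_measurable borel"
proof (rule borel_measurableI_greater)
  fix c :: real
  have "open {p. c < frac (rep_torus p $ i)}"
  proof (cases "c < 0")
    case True
    then have "{p. c < frac (rep_torus p $ i)} = UNIV"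
      using frac_ge_0 by (auto intro: less_le_trans)
    then show ?thesis by simp
  next
    case False
    have "frac (rep_torus (torus_proj x) $ i) = frac (x $ i)" for x
      by (rule periodic_rep_torus_proj) (simp add: int_vec_def frac_def)
    then have "torus_proj -` {p. c < frac (rep_torus p $ i)} = {x. c < frac (x $ i)}" by simp
    also have "\<dots> = (\<Union>n::int. {x. of_int n + c < x $ i} \<inter> {x. x $ i < of_int n + 1})"
    proof (intro equalityI subsetI)
      fix x assume "x \<in> {x. c < frac (x $ i)}"
      then show "x \<in> (\<Union>n::int. {x. of_int n + c < x $ i} \<inter> {x. x $ i < of_int n + 1})"
        by (intro UN_I[of "\<lfloor>x $ i\<rfloor>"]) (auto simp: frac_def)
    next
      fix x :: "real^2" assume "x \<in> (\<Union>n::int. {x. of_int n + c < x $ i} \<inter> {x. x $ i < of_int n + 1})"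
      then obtain n :: int where n: "of_int n + c < x $ i" "x $ i < of_int n + 1" by auto
      then have "\<lfloor>x $ i\<rfloor> = n" using False by (intro floor_unique) auto
      then show "x \<in> {x. c < frac (x $ i)}" using n by (simp add: frac_def)
    qed
    also have "open \<dots>"
      by (intro open_UN ballI open_Int open_Collect_less continuous_intros)
    finally show ?thesis by (simp add: open_torus_def)
  qed
  then show "{p \<in> space borel. c < frac (rep_torus p $ i)} \<in> sets borel" by simp
qed

text \<open>The transfer device between torus and line: measures go to the line along
  \<open>s\<close> and return along \<open>c\<close>. Boundedness of \<open>s\<close> will give
  tightness, continuity of \<open>c\<close> lets weak limits come back.\<close>

lemma torus_curve:
  obtains c :: "real \<Rightarrow> torus" and s :: "torus \<Rightarrow> real"
  where "continuous_on UNIV c" "s \<in> borel_measurable borel" "\<And>p. s p \<in> {0..1}" "\<And>p. c (s p) = p"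
proof
  define c where "c = (\<lambda>t. torus_proj (\<chi> i. schoenberg (if i = 1 then 0 else 1) t))"
  define s where "s = (\<lambda>p. schoenberg_section (frac (rep_torus p $ 1)) (frac (rep_torus p $ 2)))"
  show "continuous_on UNIV c"
    unfolding c_def by (intro continuous_on_compose2[OF continuous_on_torus_proj] continuous_intros
      continuous_on_schoenberg) auto
  have "(\<lambda>p. binary_digit (if even n then frac (rep_torus p $ 1) else frac (rep_torus p $ 2)) (n div 2))
      \<in> borel_measurable borel" for n
    using borel_measurable_torus_frac unfolding binary_digit_def by (cases "even n") auto
  then show "s \<in> borel_measurable borel"
    unfolding s_def schoenberg_section_def cantor_sum_def by (intro borel_measurable_suminf) simp
  show "s p \<in> {0..1}" for p
    unfolding s_def schoenberg_section_def
  proof (rule cantor_sum_bounds)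
    show "binary_digit (if even n then frac (rep_torus p $ 1) else frac (rep_torus p $ 2)) (n div 2) \<in> {0..1}" for n
      using binary_digit_range[of "if even n then frac (rep_torus p $ 1) else frac (rep_torus p $ 2)" "n div 2"]
      by auto
  qed
  show "c (s p) = p" for p
  proof -
    have "schoenberg (if i = 1 then 0 else 1) (s p) = frac (rep_torus p $ i)" for i
      using exhaust_2[of i] unfolding s_def by (auto simp: schoenberg_section frac_lt_1 simp del: One_nat_def)
    then have "c (s p) = torus_proj (\<chi> i. frac (rep_torus p $ i))"
      unfolding c_def by simp
    also have "\<dots> = torus_proj (rep_torus p)"
      unfolding torus_proj_eq_iff by (simp add: frac_def)
    finally show ?thesis by simp
  qed
qed

section \<open>Weak sequential compactness\<close>

lemma open_torus_proj_image:
  assumes "open U" shows "open (torus_proj ` U)"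
proof -
  have "torus_proj -` (torus_proj ` U) = (\<Union>v. (+) (int_vec v) ` U)"
    by (auto simp: image_iff elim!: torus_proj_eq_imp_int_vec)
      (metis add.commute, metis add.commute torus_proj_add_int_vec)
  then show ?thesis using assms by (auto simp: open_torus_def intro: open_translation)
qed

instance torus :: second_countable_topology
proof
  obtain B :: "(real^2) set set" where B: "countable B" "topological_basis B"
    using ex_countable_basis by blast
  have "topological_basis ((`) torus_proj ` B)"
  proof (rule topological_basisI)
    show "open U" if "U \<in> (`) torus_proj ` B" for U
      using that B(2) by (auto intro: open_torus_proj_image topological_basis_open)
    fix U :: "torus set" and p assume U: "open U" "p \<in> U"
    then have "open (torus_proj -` U)" "rep_torus p \<in> torus_proj -` U"
      by (simp_all add: open_torus_def)
    then obtain V where "V \<in> B" "rep_torus p \<in> V" "V \<subseteq> torus_proj -` U"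
      using topological_basisE[OF B(2)] by metis
    then show "\<exists>W\<in>(`) torus_proj ` B. p \<in> W \<and> W \<subseteq> U"
      by (intro bexI[of _ "torus_proj ` V"]) (auto simp: image_iff intro!: bexI[of _ "rep_torus p"])
  qed
  then show "\<exists>B :: torus set set. countable B \<and> open = generate_topology B"
    using B(1) by (intro exI[of _ "(`) torus_proj ` B"]) (auto intro: topological_basis_imp_subbasis)
qed

text \<open>Continuous functions increasing to the indicator of an open \<open>U\<close>, with
  distances taken in the plane to the periodic complement. The case \<open>U = UNIV\<close> is
  separate because \<open>infdist\<close> to the empty set is 0 by convention.\<close>

definition bump :: "torus set \<Rightarrow> nat \<Rightarrow> torus \<Rightarrow> real" where
  "bump U n p = (if U = UNIV then 1 else min 1 (real n * infdist (rep_torus p) (- (torus_proj -` U))))"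

text \<open>The complement upstairs is mapped to itself by integer translations, which are
  isometries. One inequality for every \<open>v\<close>, used again with \<open>- v\<close>, gives
  equality.\<close>

lemma infdist_periodic: "infdist (x + int_vec v) (- (torus_proj -` U)) = infdist x (- (torus_proj -` U))"
proof (cases "- (torus_proj -` U) = {}")
  case True then show ?thesis by (simp add: infdist_def)
next
  case False
  have le: "infdist (x + int_vec v) (- (torus_proj -` U)) \<le> infdist x (- (torus_proj -` U))" for x v
  proof -
    have "infdist (x + int_vec v) (- (torus_proj -` U)) \<le> dist x y" if "y \<in> - (torus_proj -` U)" for y
      using infdist_le[of "y + int_vec v" "- (torus_proj -` U)" "x + int_vec v"] that by simp
    then show ?thesis
      unfolding infdist_def[of x] if_not_P[OF False] using False by (intro cINF_greatest) auto
  qed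
  show ?thesis
    using le[of x v] le[of "x + int_vec v" "- v"] by (simp add: int_vec_minus)
qed

lemma continuous_on_bump: "continuous_on UNIV (bump U n)"
proof (cases "U = UNIV")
  case True then show ?thesis by (simp add: bump_def[abs_def])
next
  case False
  have "continuous_on UNIV (\<lambda>p. min 1 (real n * infdist (rep_torus p) (- (torus_proj -` U))))"
    by (rule continuous_on_periodic_torus) (auto intro!: continuous_intros simp: infdist_periodic)
  then show ?thesis using False by (simp add: bump_def[abs_def])
qed

lemma bump_tendsto_indicator:
  assumes "open U" shows "(\<lambda>n. bump U n p) \<longlonglongrightarrow> indicator U p"
proof (cases "U = UNIV")
  case True then show ?thesis by (simp add: bump_def)
next
  case False
  define C where "C = - (torus_proj -` U)"
  define d where "d = infdist (rep_torus p) C"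
  have C: "closed C" "C \<noteq> {}"
    using assms False unfolding C_def
    by (auto simp: open_torus_def) (metis Compl_empty_eq UNIV_I double_complement torus_proj_rep vimage_eq)
  have b: "bump U n p = min 1 (real n * d)" for n using False by (simp add: bump_def d_def C_def)
  show ?thesis
  proof (cases "p \<in> U")
    case True
    then have "d > 0"
      using C infdist_pos_not_in_closed[of C "rep_torus p"] by (auto simp: d_def C_def)
    then obtain N where N: "1 < real N * d" using reals_Archimedean3 by metis
    have "bump U n p = 1" if "n \<ge> N" for n
      using that N \<open>d > 0\<close> unfolding b
      by (smt (verit) mult_right_mono of_nat_mono)
    then have "\<forall>\<^sub>F n in sequentially. bump U n p = 1" by (auto simp: eventually_sequentially)
    then show ?thesis using True by (simp add: tendsto_eventually)
  next
    case False
    then have "d = 0" by (simp add: d_def C_def)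
    then show ?thesis using False by (simp add: b)
  qed
qed

definition prob_borel :: "torus measure \<Rightarrow> bool" where
  "prob_borel \<nu> \<longleftrightarrow> prob_space \<nu> \<and> sets \<nu> = sets borel"

lemma prob_borel_space: "prob_borel \<nu> \<Longrightarrow> space \<nu> = UNIV"
  unfolding prob_borel_def by (metis sets_eq_imp_space_eq space_borel)

lemma continuous_torus_measurable:
  fixes f :: "torus \<Rightarrow> 'a::topological_space"
  assumes "continuous_on UNIV f" "prob_borel \<nu>" shows "f \<in> borel_measurable \<nu>"
  using borel_measurable_continuous_onI[OF assms(1)] assms(2) measurable_cong_sets[of \<nu> borel]
  unfolding prob_borel_def by blast

lemma continuous_torus_bounded:
  fixes f :: "torus \<Rightarrow> 'a::real_normed_vector"
  assumes "continuous_on UNIV f"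
  obtains B where "\<And>p. norm (f p) \<le> B"
proof -
  have "bounded (range f)"
    by (intro compact_imp_bounded compact_continuous_image assms compact_UNIV_torus)
  then obtain B where "\<And>p. norm (f p) \<le> B" by (auto simp: bounded_iff)
  then show ?thesis by (rule that)
qed

lemma continuous_torus_integrable:
  fixes f :: "torus \<Rightarrow> 'a::{banach, second_countable_topology}"
  assumes "continuous_on UNIV f" "prob_borel \<nu>" shows "integrable \<nu> f"
proof -
  interpret prob_space \<nu> using assms(2) by (simp add: prob_borel_def)
  obtain B where "\<And>p. norm (f p) \<le> B" using continuous_torus_bounded[OF assms(1)] by blast
  then show ?thesis
    by (intro integrable_const_bound[where B = B] continuous_torus_measurable assms) auto
qed

lemma bump_range: "bump U n p \<in> {0..1}"
  by (simp add: bump_def infdist_nonneg)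

lemma integral_bump_tendsto:
  assumes "open U" "prob_borel \<nu>"
  shows "(\<lambda>n. \<integral>p. bump U n p \<partial>\<nu>) \<longlonglongrightarrow> measure \<nu> U"
proof -
  interpret prob_space \<nu> using assms(2) by (simp add: prob_borel_def)
  have "(\<lambda>n. \<integral>p. bump U n p \<partial>\<nu>) \<longlonglongrightarrow> (\<integral>p. indicator U p \<partial>\<nu>)"
  proof (rule integral_dominated_convergence[where w = "\<lambda>_. 1"])
    show "indicator U \<in> borel_measurable \<nu>"
      using assms by (intro borel_measurable_indicator) (auto simp: prob_borel_def)
    show "bump U n \<in> borel_measurable \<nu>" for n
      by (rule continuous_torus_measurable[OF continuous_on_bump assms(2)])
    show "AE p in \<nu>. norm (bump U n p) \<le> 1" for n using bump_range[of U n] by auto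
  qed (auto intro: bump_tendsto_indicator assms)
  then show ?thesis using prob_borel_space[OF assms(2)] by simp
qed

text \<open>Finite intersections turn a countable basis into a countable \<open>\<pi>\<close>-system.\<close>

lemma countable_determining_functions:
  obtains fs :: "nat \<Rightarrow> torus \<Rightarrow> real"
  where "\<And>k. continuous_on UNIV (fs k)"
    and "\<And>\<mu> \<nu>. prob_borel \<mu> \<Longrightarrow> prob_borel \<nu> \<Longrightarrow>
           (\<And>k. (\<integral>p. fs k p \<partial>\<mu>) = (\<integral>p. fs k p \<partial>\<nu>)) \<Longrightarrow> \<mu> = \<nu>"
proof -
  obtain B :: "torus set set" where B: "countable B" "topological_basis B"
    using ex_countable_basis by blast
  define E where "E = Inter ` {F. finite F \<and> F \<subseteq> B}"
  have cE: "countable E"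
    unfolding E_def using B(1) by (intro countable_image countable_Collect_finite_subset)
  have UE: "UNIV \<in> E" unfolding E_def by (rule image_eqI[of _ _ "{}"]) auto
  have oE: "open U" if "U \<in> E" for U
    using that B(2) by (auto simp: E_def intro!: open_Inter dest: topological_basis_open)
  have BE: "B \<subseteq> E" unfolding E_def by (auto intro!: image_eqI[of _ Inter "{_}"])
  have iE: "Int_stable E"
  proof (rule Int_stableI)
    fix a b assume "a \<in> E" "b \<in> E"
    then obtain F F' where "a = \<Inter>F" "finite F" "F \<subseteq> B" "b = \<Inter>F'" "finite F'" "F' \<subseteq> B"
      by (auto simp: E_def)
    then show "a \<inter> b \<in> E"
      unfolding E_def by (intro image_eqI[of _ _ "F \<union> F'"]) auto
  qed
  have sE: "sets borel = sigma_sets UNIV E"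
  proof
    have "sets borel = sigma_sets UNIV B"
      by (subst borel_eq_countable_basis[OF B]) simp
    then show "sets borel \<subseteq> sigma_sets UNIV E" using BE by (metis sigma_sets_mono')
    show "sigma_sets UNIV E \<subseteq> sets borel"
      using oE sets.sigma_sets_subset[of E borel] by (metis borel_open space_borel subsetI)
  qed
  \<comment> \<open>One index \<open>k\<close> encodes a set of the \<pi>-system and an
    approximation level. Letting the level grow recovers the measure of each set from the
    integrals.\<close>
  define fs where "fs = (\<lambda>k. case prod_decode k of (i, n) \<Rightarrow> bump (from_nat_into E i) n)"
  show ?thesis
  proof
    show "continuous_on UNIV (fs k)" for k
      by (simp add: fs_def continuous_on_bump split: prod.split)
    fix \<mu> \<nu> assume p: "prob_borel \<mu>" "prob_borel \<nu>"
      and eq: "\<And>k. (\<integral>p. fs k p \<partial>\<mu>) = (\<integral>p. fs k p \<partial>\<nu>)"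
    interpret \<mu>: prob_space \<mu> using p by (simp add: prob_borel_def)
    interpret \<nu>: prob_space \<nu> using p by (simp add: prob_borel_def)
    show "\<mu> = \<nu>"
    proof (rule measure_eqI_generator_eq[OF iE, of UNIV \<mu> \<nu> "\<lambda>_. UNIV"])
      fix U assume U: "U \<in> E"
      then obtain i where i: "from_nat_into E i = U"
        using from_nat_into_surj[OF cE] by blast
      have "(\<integral>p. bump U n p \<partial>\<mu>) = (\<integral>p. bump U n p \<partial>\<nu>)" for n
        using eq[of "prod_encode (i, n)"] by (simp add: fs_def i)
      then have "measure \<mu> U = measure \<nu> U"
        using LIMSEQ_unique[OF integral_bump_tendsto[OF oE[OF U] p(1)]]
          integral_bump_tendsto[OF oE[OF U] p(2)] by presburger
      then show "emeasure \<mu> U = emeasure \<nu> U"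
        by (simp add: \<mu>.emeasure_eq_measure \<nu>.emeasure_eq_measure)
    qed (use p sE UE in \<open>auto simp: prob_borel_def\<close>)
  qed
qed

lemma prob_borel_eqI:
  assumes "prob_borel \<mu>" "prob_borel \<nu>"
    and "\<And>f :: torus \<Rightarrow> real. continuous_on UNIV f \<Longrightarrow> (\<integral>p. f p \<partial>\<mu>) = (\<integral>p. f p \<partial>\<nu>)"
  shows "\<mu> = \<nu>"
  using countable_determining_functions assms by metis

lemma prob_borel_distr:
  assumes "prob_borel \<nu>" "continuous_on UNIV k" shows "prob_borel (distr \<nu> borel k)"
proof -
  interpret prob_space \<nu> using assms(1) by (simp add: prob_borel_def)
  show ?thesis
    using prob_space_distr[OF continuous_torus_measurable[OF assms(2,1)]] by (simp add: prob_borel_def)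
qed

lemma integral_distr_continuous:
  fixes f :: "torus \<Rightarrow> 'a::{banach, second_countable_topology}"
  assumes "prob_borel \<nu>" "continuous_on UNIV k" "continuous_on UNIV f"
  shows "(\<integral>p. f p \<partial>distr \<nu> borel k) = (\<integral>p. f (k p) \<partial>\<nu>)"
  by (intro integral_distr continuous_torus_measurable assms borel_measurable_continuous_onI)

text \<open>The images under \<open>s\<close> live on \<open>[0,1]\<close> and are therefore tight,
  so a subsequence converges weakly on the line. The limit is pushed back by \<open>c\<close>; since
  \<open>c (s p) = p\<close>, integrating \<open>f\<close> on the torus is integrating
  \<open>f \<circ> c\<close> on the line.\<close>

lemma prob_borel_convergent_subseq:
  assumes \<mu>: "\<And>n. prob_borel (\<mu> n)"
  obtains r :: "nat \<Rightarrow> nat" and \<nu> where "strict_mono r" "prob_borel \<nu>"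
    "\<And>f :: torus \<Rightarrow> real. continuous_on UNIV f \<Longrightarrow>
       (\<lambda>n. \<integral>p. f p \<partial>\<mu> (r n)) \<longlonglongrightarrow> (\<integral>p. f p \<partial>\<nu>)"
proof -
  obtain c :: "real \<Rightarrow> torus" and s where c: "continuous_on UNIV c" and s: "s \<in> borel_measurable borel"
      "\<And>p. s p \<in> {0..1}" "\<And>p. c (s p) = p"
    using torus_curve by blast
  have sm: "s \<in> borel_measurable (\<mu> n)" for n
    using s(1) \<mu>[of n] measurable_cong_sets[of "\<mu> n" borel] unfolding prob_borel_def by blast
  have cm: "c \<in> measurable borel borel" by (rule borel_measurable_continuous_onI[OF c])
  define M where "M = (\<lambda>n. distr (\<mu> n) borel s)"
  have dM: "real_distribution (M n)" for n
    unfolding M_def using \<mu>[of n] sm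
    by (intro prob_space.real_distribution_distr) (auto simp: prob_borel_def)
  have "tight M"
    unfolding tight_def
  proof (intro conjI allI impI dM)
    fix \<epsilon> :: real assume "0 < \<epsilon>"
    \<comment> \<open>Tightness is stated with intervals open on the left; the endpoint -1 keeps the
      possible value 0 of \<open>s\<close> inside.\<close>
    have "measure (M n) {-1<..1} = 1" for n
    proof -
      interpret prob_space "\<mu> n" using \<mu>[of n] by (simp add: prob_borel_def)
      have "s -` {-1<..1} \<inter> space (\<mu> n) = space (\<mu> n)" using s(2) by force
      then show ?thesis unfolding M_def by (subst measure_distr[OF sm]) (auto simp: prob_space)
    qed
    then show "\<exists>a b. a < b \<and> (\<forall>n. 1 - \<epsilon> < measure (M n) {a<..b})"
      using \<open>0 < \<epsilon>\<close> by (intro exI[of _ "-1"] exI[of _ 1]) auto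
  qed
  from tight_imp_convergent_subsubsequence[OF this strict_mono_id]
  obtain r N where r: "strict_mono r" and N: "real_distribution N" and "weak_conv_m (M \<circ> id \<circ> r) N"
    by auto
  then have w: "weak_conv_m (\<lambda>n. M (r n)) N" by (simp add: o_def)
  interpret N: real_distribution N by (rule N)
  have cN: "c \<in> measurable N borel" using cm by simp
  show ?thesis
  proof (rule that[OF r])
    show "prob_borel (distr N borel c)"
      using N.prob_space_distr[OF cN] by (simp add: prob_borel_def)
    fix f :: "torus \<Rightarrow> real" assume f: "continuous_on UNIV f"
    obtain B where B: "\<And>p. norm (f p) \<le> B" using continuous_torus_bounded[OF f] by blast
    have fm: "f \<in> borel_measurable borel" by (rule borel_measurable_continuous_onI[OF f])
    have "continuous_on UNIV (\<lambda>t. f (c t))" using continuous_on_compose2[OF f c] by auto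
    then have "isCont (\<lambda>t. f (c t)) t" for t by (simp add: continuous_on_eq_continuous_at)
    from weak_conv_imp_integral_bdd_continuous_conv[OF dM N w this B]
    have "(\<lambda>n. \<integral>t. f (c t) \<partial>M (r n)) \<longlonglongrightarrow> (\<integral>t. f (c t) \<partial>N)" .
    moreover have "(\<integral>t. f (c t) \<partial>M n) = (\<integral>p. f p \<partial>\<mu> n)" for n
      unfolding M_def using fm cm by (subst integral_distr[OF sm]) (auto simp: s(3))
    ultimately show "(\<lambda>n. \<integral>p. f p \<partial>\<mu> (r n)) \<longlonglongrightarrow> (\<integral>p. f p \<partial>distr N borel c)"
      using fm by (simp add: integral_distr[OF cN])
  qed
qed

section \<open>Invariant measures under constraints\<close>

lemma tendsto_fun_componentwise:
  fixes f :: "nat \<Rightarrow> 'i \<Rightarrow> 'b::topological_space"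
  assumes "\<And>i. (\<lambda>n. f n i) \<longlonglongrightarrow> l i" shows "f \<longlonglongrightarrow> l"
proof -
  have "limitin (product_topology (\<lambda>i. euclidean) UNIV) f l sequentially"
    using assms by (simp add: limitin_componentwise)
  then show ?thesis by (simp add: euclidean_product_topology)
qed

text \<open>The mean of finitely many measures is realised as a mixture, the \<open>bind\<close>
  over the uniform distribution on the index set.\<close>

lemma prob_borel_average:
  assumes \<mu>: "\<And>j. prob_borel (\<mu> j)" and N: "N > 0"
  obtains \<nu> where "prob_borel \<nu>"
    "\<And>f :: torus \<Rightarrow> real. continuous_on UNIV f \<Longrightarrow>
       (\<integral>p. f p \<partial>\<nu>) = (\<Sum>j<N. \<integral>p. f p \<partial>\<mu> j) / real N"
proof -
  define M where "M = measure_pmf (pmf_of_set {..<N})"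
  have Ne: "{..<N} \<noteq> {}" using N by auto
  have k: "\<mu> j \<in> space (prob_algebra borel)" for j
    using \<mu>[of j] by (simp add: space_prob_algebra prob_borel_def)
  then have km: "\<mu> \<in> measurable M (prob_algebra borel)"
    unfolding M_def by (simp add: measurable_pmf_measure1)
  then have ks: "\<mu> \<in> measurable M (subprob_algebra borel)"
    by (rule measurable_prob_algebraD)
  have pM: "prob_space M" unfolding M_def by (rule prob_space_measure_pmf)
  interpret M: prob_space M by (rule pM)
  show ?thesis
  proof (rule that[of "bind M \<mu>"])
    have "prob_space (bind M \<mu>)"
      using \<mu> ks by (intro M.prob_space_bind[where S = borel]) (auto simp: prob_borel_def)
    moreover have "sets (bind M \<mu>) = sets borel"
      using \<mu> by (intro sets_bind) (auto simp: prob_borel_def M_def)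
    ultimately show "prob_borel (bind M \<mu>)" by (simp add: prob_borel_def)
    fix f :: "torus \<Rightarrow> real" assume f: "continuous_on UNIV f"
    obtain B where B: "\<And>p. norm (f p) \<le> B" using continuous_torus_bounded[OF f] by blast
    have "(\<integral>p. f p \<partial>bind M \<mu>) = (\<integral>j. (\<integral>p. f p \<partial>\<mu> j) \<partial>M)"
    proof (rule integral_bind[OF _ _ ks])
      show "f \<in> borel_measurable borel" by (rule borel_measurable_continuous_onI[OF f])
      show "finite_measure M" by unfold_locales
      show "AE j in M. emeasure (\<mu> j) (space (\<mu> j)) \<le> ennreal 1"
        using \<mu> by (auto simp: prob_borel_def prob_space.emeasure_space_1)
      show "\<bar>f p\<bar> \<le> B" for p using B[of p] by simp
    qed
    also have "\<dots> = (\<Sum>j<N. \<integral>p. f p \<partial>\<mu> j) / real N"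
      unfolding M_def by (subst integral_pmf_of_set) (use Ne in auto)
    finally show "(\<integral>p. f p \<partial>bind M \<mu>) = (\<Sum>j<N. \<integral>p. f p \<partial>\<mu> j) / real N" .
  qed
qed

text \<open>Affine equations between a measure and continuous functions are the common language for
  prescribed rotation vectors and for invariance. For continuous \<open>f\<close> the solution set
  is convex and weakly closed.\<close>

definition prob_constrained :: "((torus \<Rightarrow> real) \<times> real) set \<Rightarrow> torus measure set" where
  "prob_constrained L = {\<nu>. prob_borel \<nu> \<and> (\<forall>(f, c) \<in> L. (\<integral>p. f p \<partial>\<nu>) = c)}"

lemma prob_constrained_antimono: "K \<subseteq> L \<Longrightarrow> prob_constrained L \<subseteq> prob_constrained K"
  by (auto simp: prob_constrained_def)

text \<open>The integrals of countably many determining functions embed the measures into the space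
  of real sequences. Constrained sets have compact images there, so the finite intersection property
  applies, and injectivity brings the common point back to one measure.\<close>

lemma prob_constrained_finite_intersection:
  assumes cont: "\<And>f c. (f, c) \<in> L \<Longrightarrow> continuous_on UNIV f"
    and fin: "\<And>L'. finite L' \<Longrightarrow> L' \<subseteq> L \<Longrightarrow> prob_constrained L' \<noteq> {}"
  shows "prob_constrained L \<noteq> {}"
proof -
  obtain fs :: "nat \<Rightarrow> torus \<Rightarrow> real" where fs: "\<And>k. continuous_on UNIV (fs k)"
    and det: "\<And>\<mu> \<nu>. prob_borel \<mu> \<Longrightarrow> prob_borel \<nu> \<Longrightarrow>
           (\<And>k. (\<integral>p. fs k p \<partial>\<mu>) = (\<integral>p. fs k p \<partial>\<nu>)) \<Longrightarrow> \<mu> = \<nu>"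
    using countable_determining_functions by blast
  define \<Phi> where "\<Phi> = (\<lambda>\<nu> k. \<integral>p. fs k p \<partial>\<nu>)"
  have inj: "\<mu> = \<nu>" if "prob_borel \<mu>" "prob_borel \<nu>" "\<Phi> \<mu> = \<Phi> \<nu>" for \<mu> \<nu>
    using det[OF that(1,2)] fun_cong[OF that(3)] by (simp add: \<Phi>_def)
  have comp: "compact (\<Phi> ` prob_constrained K)" if K: "K \<subseteq> L" for K
  \<comment> \<open>The sequence space is second countable, so the subsequence extraction for
    measures is enough.\<close>
  proof (subst seq_compact_eq_compact[symmetric], rule seq_compactI)
    fix x :: "nat \<Rightarrow> nat \<Rightarrow> real" assume "\<forall>n. x n \<in> \<Phi> ` prob_constrained K"
    then have "\<exists>\<nu>. \<forall>n. \<nu> n \<in> prob_constrained K \<and> x n = \<Phi> (\<nu> n)"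
      by (intro choice) (auto simp: image_iff)
    then obtain \<nu> where \<nu>: "\<And>n. \<nu> n \<in> prob_constrained K" and x: "x = (\<lambda>n. \<Phi> (\<nu> n))"
      by auto
    have "prob_borel (\<nu> n)" for n using \<nu>[of n] by (simp add: prob_constrained_def)
    from prob_borel_convergent_subseq[of \<nu>, OF this] obtain r :: "nat \<Rightarrow> nat" and \<mu>
      where r: "strict_mono r" and \<mu>: "prob_borel \<mu>"
        and lim: "\<And>f :: torus \<Rightarrow> real. continuous_on UNIV f \<Longrightarrow>
          (\<lambda>n. \<integral>p. f p \<partial>\<nu> (r n)) \<longlonglongrightarrow> (\<integral>p. f p \<partial>\<mu>)"
      by blast
    have "(\<integral>p. f p \<partial>\<mu>) = c" if fc: "(f, c) \<in> K" for f c
    proof -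
      have "(\<integral>p. f p \<partial>\<nu> n) = c" for n
        using \<nu>[of n] fc by (auto simp: prob_constrained_def)
      then show ?thesis
        using lim[OF cont[of f c]] K fc by (auto simp: LIMSEQ_const_iff)
    qed
    then have "\<mu> \<in> prob_constrained K" using \<mu> by (auto simp: prob_constrained_def)
    moreover have "(x \<circ> r) \<longlonglongrightarrow> \<Phi> \<mu>"
      unfolding x \<Phi>_def o_def by (rule tendsto_fun_componentwise) (rule lim[OF fs])
    ultimately show "\<exists>l\<in>\<Phi> ` prob_constrained K. \<exists>r. strict_mono r \<and> (x \<circ> r) \<longlonglongrightarrow> l"
      using r by blast
  qed
  \<comment> \<open>The factor with no constraints is the compact ambient set; it also covers empty
    \<open>L\<close>.\<close>
  have "\<Phi> ` prob_constrained {} \<inter> (\<Inter>l\<in>L. \<Phi> ` prob_constrained {l}) \<noteq> {}"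
  proof (rule compact_imp_fip_image[OF comp])
    show "closed (\<Phi> ` prob_constrained {l})" if "l \<in> L" for l
      using that by (intro compact_imp_closed comp) auto
    fix L' assume L': "finite L'" "L' \<subseteq> L"
    have "\<Phi> ` prob_constrained L' \<subseteq> \<Phi> ` prob_constrained {} \<inter> (\<Inter>l\<in>L'. \<Phi> ` prob_constrained {l})"
      by (auto simp: prob_constrained_def)
    with fin[OF L'] show "\<Phi> ` prob_constrained {} \<inter> (\<Inter>l\<in>L'. \<Phi> ` prob_constrained {l}) \<noteq> {}"
      by blast
  qed simp
  then obtain \<nu> where \<nu>: "prob_borel \<nu>" and "\<And>l. l \<in> L \<Longrightarrow> \<Phi> \<nu> \<in> \<Phi> ` prob_constrained {l}"
    by (auto simp: prob_constrained_def)
  then have \<Phi>\<nu>: "\<exists>\<mu> \<in> prob_constrained {l}. \<Phi> \<nu> = \<Phi> \<mu>" if "l \<in> L" for l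
    using that by blast
  have "\<nu> \<in> prob_constrained {l}" if "l \<in> L" for l
  proof -
    obtain \<mu> where \<mu>: "\<mu> \<in> prob_constrained {l}" "\<Phi> \<nu> = \<Phi> \<mu>"
      using \<Phi>\<nu>[OF \<open>l \<in> L\<close>] by blast
    moreover have "prob_borel \<mu>" using \<mu>(1) by (simp add: prob_constrained_def)
    ultimately show ?thesis using inj[OF \<nu>] by metis
  qed
  then have "\<nu> \<in> prob_constrained L" using \<nu> by (simp add: prob_constrained_def)
  then show ?thesis by blast
qed

text \<open>Invariance becomes a family of affine equations, so that it can be adjoined to other
  constraints.\<close>

lemma distr_fixed_iff:
  assumes "prob_borel \<nu>" "continuous_on UNIV k"
  shows "distr \<nu> borel k = \<nu> \<longleftrightarrow>
    (\<forall>f :: torus \<Rightarrow> real. continuous_on UNIV f \<longrightarrow> (\<integral>p. f (k p) - f p \<partial>\<nu>) = 0)"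
proof -
  have "(\<integral>p. f (k p) - f p \<partial>\<nu>) = (\<integral>p. f p \<partial>distr \<nu> borel k) - (\<integral>p. f p \<partial>\<nu>)"
    if f: "continuous_on UNIV f" for f :: "torus \<Rightarrow> real"
  proof -
    have "continuous_on UNIV (\<lambda>p. f (k p))" using continuous_on_compose2[OF f assms(2)] by auto
    then show ?thesis
      using assms f by (simp add: continuous_torus_integrable integral_distr_continuous)
  qed
  then show ?thesis
    using prob_borel_eqI[OF prob_borel_distr[OF assms] assms(1)] by auto
qed

text \<open>The Krylov-Bogolyubov argument inside a constraint set: averages of the iterated
  push-forwards still satisfy the affine constraints, and any weak limit of them is
  invariant.\<close>

lemma prob_constrained_fixed_point:
  assumes cont: "\<And>f c. (f, c) \<in> L \<Longrightarrow> continuous_on UNIV f"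
    and ne: "prob_constrained L \<noteq> {}"
    and k: "continuous_on UNIV k"
    and inv: "\<And>\<nu>. \<nu> \<in> prob_constrained L \<Longrightarrow> distr \<nu> borel k \<in> prob_constrained L"
  shows "\<exists>\<nu> \<in> prob_constrained L. distr \<nu> borel k = \<nu>"
proof -
  obtain \<nu>0 where \<nu>0: "\<nu>0 \<in> prob_constrained L" using ne by blast
  define \<mu> where "\<mu> = (\<lambda>j. ((\<lambda>\<nu>. distr \<nu> borel k) ^^ j) \<nu>0)"
  have \<mu>: "\<mu> j \<in> prob_constrained L" for j
    unfolding \<mu>_def by (induction j) (auto simp: \<nu>0 inv)
  then have p\<mu>: "prob_borel (\<mu> j)" for j by (simp add: prob_constrained_def)
  have "\<exists>\<nu>. prob_borel \<nu> \<and> (\<forall>f :: torus \<Rightarrow> real. continuous_on UNIV f \<longrightarrow>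
       (\<integral>p. f p \<partial>\<nu>) = (\<Sum>j<Suc n. \<integral>p. f p \<partial>\<mu> j) / real (Suc n))" for n
    using prob_borel_average[of \<mu> "Suc n", OF p\<mu> zero_less_Suc] by metis
  then obtain A where A: "\<And>n. prob_borel (A n)"
    and iA: "\<And>n (f :: torus \<Rightarrow> real). continuous_on UNIV f \<Longrightarrow>
       (\<integral>p. f p \<partial>A n) = (\<Sum>j<Suc n. \<integral>p. f p \<partial>\<mu> j) / real (Suc n)"
    by metis
  obtain r :: "nat \<Rightarrow> nat" and \<nu> where r: "strict_mono r" and \<nu>: "prob_borel \<nu>"
    and lim: "\<And>f :: torus \<Rightarrow> real. continuous_on UNIV f \<Longrightarrow>
          (\<lambda>n. \<integral>p. f p \<partial>A (r n)) \<longlonglongrightarrow> (\<integral>p. f p \<partial>\<nu>)"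
    using prob_borel_convergent_subseq[of A, OF A] by blast
  have "(\<integral>p. f p \<partial>\<nu>) = c" if fc: "(f, c) \<in> L" for f c
  proof -
    have "(\<integral>p. f p \<partial>\<mu> j) = c" for j using \<mu>[of j] fc by (auto simp: prob_constrained_def)
    then have "(\<integral>p. f p \<partial>A n) = c" for n by (simp add: iA cont[OF fc] del: of_nat_Suc)
    then show ?thesis using lim[OF cont[OF fc]] by (simp add: LIMSEQ_const_iff)
  qed
  then have "\<nu> \<in> prob_constrained L" using \<nu> by (auto simp: prob_constrained_def)
  moreover have "(\<integral>p. f (k p) - f p \<partial>\<nu>) = 0" if f: "continuous_on UNIV f" for f :: "torus \<Rightarrow> real"
  proof -
    obtain B where B: "\<And>p. norm (f p) \<le> B" using continuous_torus_bounded[OF f] by blast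
    define a where "a = (\<lambda>j. \<integral>p. f p \<partial>\<mu> j)"
    have aB: "\<bar>a j\<bar> \<le> B" for j
    proof -
      interpret prob_space "\<mu> j" using p\<mu>[of j] by (simp add: prob_borel_def)
      have "\<bar>a j\<bar> \<le> (\<integral>p. \<bar>f p\<bar> \<partial>\<mu> j)" unfolding a_def by (rule integral_abs_bound)
      also have "\<dots> \<le> (\<integral>p. B \<partial>\<mu> j)"
        using B f p\<mu>[of j] by (intro integral_mono continuous_torus_integrable continuous_intros) auto
      finally show ?thesis by (simp add: prob_space)
    qed
    have fk: "continuous_on UNIV (\<lambda>p. f (k p))" using continuous_on_compose2[OF f k] by auto
    have step: "(\<integral>p. f (k p) - f p \<partial>\<mu> j) = a (Suc j) - a j" for j
      using p\<mu>[of j] f fk k by (simp add: a_def \<mu>_def continuous_torus_integrable integral_distr_continuous)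
    \<comment> \<open>Averaging telescopes; only the two end terms remain, divided by the number of
      iterates.\<close>
    have "(\<integral>p. f (k p) - f p \<partial>A n) = (a (Suc n) - a 0) / real (Suc n)" for n
    proof -
      have "(\<integral>p. f (k p) - f p \<partial>A n) = (\<Sum>j<Suc n. a (Suc j) - a j) / real (Suc n)"
        using f fk by (subst iA) (auto intro: continuous_intros simp: step)
      then show ?thesis by (simp add: sum_lessThan_telescope del: sum.lessThan_Suc)
    qed
    then have "norm (\<integral>p. f (k p) - f p \<partial>A n) \<le> 2 * B / real (Suc n)" for n
      using aB[of "Suc n"] aB[of 0] by (simp add: divide_right_mono del: of_nat_Suc)
    moreover have "(\<lambda>n. 2 * B / real (Suc n)) \<longlonglongrightarrow> 0"
      by (intro LIMSEQ_Suc[OF lim_const_over_n])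
    ultimately have "(\<lambda>n. \<integral>p. f (k p) - f p \<partial>A n) \<longlonglongrightarrow> 0"
      by (rule Lim_null_comparison[OF always_eventually[OF allI]])
    then have "(\<lambda>n. \<integral>p. f (k p) - f p \<partial>A (r n)) \<longlonglongrightarrow> 0"
      using LIMSEQ_subseq_LIMSEQ[OF _ r] unfolding o_def by blast
    moreover have "(\<lambda>n. \<integral>p. f (k p) - f p \<partial>A (r n)) \<longlonglongrightarrow> (\<integral>p. f (k p) - f p \<partial>\<nu>)"
      using f fk by (intro lim continuous_intros)
    ultimately show ?thesis using LIMSEQ_unique by blast
  qed
  then have "distr \<nu> borel k = \<nu>" using distr_fixed_iff[OF \<nu> k] by blast
  ultimately show ?thesis by blast
qed

definition invariance_constraints :: "(torus \<Rightarrow> torus) set \<Rightarrow> ((torus \<Rightarrow> real) \<times> real) set" where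
  "invariance_constraints K = {(\<lambda>p. f (k p) - f p, 0) | f k. k \<in> K \<and> continuous_on UNIV f}"

lemma continuous_on_invariance_constraints:
  assumes "(f, c) \<in> invariance_constraints K" and K: "\<And>k. k \<in> K \<Longrightarrow> continuous_on UNIV k"
  shows "continuous_on UNIV f"
proof -
  obtain g k where gk: "f = (\<lambda>p. g (k p) - g p)" "k \<in> K" "continuous_on UNIV g"
    using assms(1) unfolding invariance_constraints_def by blast
  have "continuous_on UNIV (\<lambda>p. g (k p))"
    using gk K by (intro continuous_on_compose2[OF gk(3)]) auto
  then show ?thesis unfolding gk(1) using gk(3) by (rule continuous_on_diff)
qed

lemma prob_constrained_invariance:
  assumes "\<And>k. k \<in> K \<Longrightarrow> continuous_on UNIV k"
  shows "prob_constrained (L \<union> invariance_constraints K) =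
    {\<nu> \<in> prob_constrained L. \<forall>k\<in>K. distr \<nu> borel k = \<nu>}"
proof -
  have "(\<forall>(f, c) \<in> invariance_constraints K. (\<integral>p. f p \<partial>\<nu>) = c) \<longleftrightarrow> (\<forall>k\<in>K. distr \<nu> borel k = \<nu>)"
    if "prob_borel \<nu>" for \<nu>
  proof -
    have "(\<forall>(f, c) \<in> invariance_constraints K. (\<integral>p. f p \<partial>\<nu>) = c) \<longleftrightarrow>
        (\<forall>k\<in>K. \<forall>f :: torus \<Rightarrow> real. continuous_on UNIV f \<longrightarrow> (\<integral>p. f (k p) - f p \<partial>\<nu>) = 0)"
      (is "?L \<longleftrightarrow> ?R")
    proof
      assume ?L
      moreover have "(\<lambda>p. f (k p) - f p, 0) \<in> invariance_constraints K"
        if "k \<in> K" "continuous_on UNIV f" for f k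
        using that unfolding invariance_constraints_def by blast
      ultimately show ?R by fastforce
    qed (auto simp: invariance_constraints_def)
    then show ?thesis using distr_fixed_iff[OF that assms] by simp
  qed
  then have "\<nu> \<in> prob_constrained (L \<union> invariance_constraints K) \<longleftrightarrow>
      \<nu> \<in> prob_constrained L \<and> (\<forall>k\<in>K. distr \<nu> borel k = \<nu>)" for \<nu>
    by (cases "prob_borel \<nu>") (simp_all add: prob_constrained_def ball_Un)
  then show ?thesis by blast
qed

text \<open>For finitely many maps, commutation makes the next map preserve the measures already
  fixed by the earlier ones, so they are adjoined one at a time. For arbitrary \<open>K\<close>, a
  finite set of constraints involves finitely many maps, and compactness concludes.\<close>

theorem markov_kakutani_torus:
  assumes cont: "\<And>f c. (f, c) \<in> L \<Longrightarrow> continuous_on UNIV f"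
    and ne: "prob_constrained L \<noteq> {}"
    and K: "\<And>k. k \<in> K \<Longrightarrow> continuous_on UNIV k"
    and inv: "\<And>k \<nu>. k \<in> K \<Longrightarrow> \<nu> \<in> prob_constrained L \<Longrightarrow> distr \<nu> borel k \<in> prob_constrained L"
    and comm: "\<And>k k' \<nu>. k \<in> K \<Longrightarrow> k' \<in> K \<Longrightarrow> \<nu> \<in> prob_constrained L \<Longrightarrow>
      distr (distr \<nu> borel k) borel k' = distr (distr \<nu> borel k') borel k"
  shows "\<exists>\<nu> \<in> prob_constrained L. \<forall>k\<in>K. distr \<nu> borel k = \<nu>"
proof -
  have icont: "continuous_on UNIV f"
    if "(f, c) \<in> L \<union> invariance_constraints K'" "K' \<subseteq> K" for f c K'
    using that cont K continuous_on_invariance_constraints by blast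
  have fin: "\<exists>\<nu> \<in> prob_constrained L. \<forall>k\<in>K'. distr \<nu> borel k = \<nu>" if "finite K'" "K' \<subseteq> K" for K'
    using that
  proof (induction K')
    case empty then show ?case using ne by blast
  next
    case (insert k K')
    let ?L = "L \<union> invariance_constraints K'"
    have eq: "prob_constrained ?L = {\<nu> \<in> prob_constrained L. \<forall>k\<in>K'. distr \<nu> borel k = \<nu>}"
      using insert.prems K by (intro prob_constrained_invariance) auto
    have "\<exists>\<nu> \<in> prob_constrained ?L. distr \<nu> borel k = \<nu>"
    proof (rule prob_constrained_fixed_point)
      show "continuous_on UNIV f" if "(f, c) \<in> ?L" for f c
        using icont[OF that] insert.prems by auto
      show "prob_constrained ?L \<noteq> {}" using insert unfolding eq by auto
      show "continuous_on UNIV k" using insert.prems K by auto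
      show "distr \<nu> borel k \<in> prob_constrained ?L" if "\<nu> \<in> prob_constrained ?L" for \<nu>
        using that insert.prems inv comm[of k _ \<nu>] unfolding eq by (auto simp: subset_iff)
    qed
    then show ?case unfolding eq by auto
  qed
  have "prob_constrained (L \<union> invariance_constraints K) \<noteq> {}"
  proof (rule prob_constrained_finite_intersection)
    show "continuous_on UNIV f" if "(f, c) \<in> L \<union> invariance_constraints K" for f c
      using icont[OF that] by auto
    fix L' assume L': "finite L'" "L' \<subseteq> L \<union> invariance_constraints K"
    have "\<exists>k. l \<in> invariance_constraints {k} \<and> k \<in> K" if "l \<in> L' - L" for l
      using that L'(2) unfolding invariance_constraints_def by blast
    then obtain \<kappa> where \<kappa>: "\<And>l. l \<in> L' - L \<Longrightarrow> l \<in> invariance_constraints {\<kappa> l} \<and> \<kappa> l \<in> K"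
      by metis
    define K' where "K' = \<kappa> ` (L' - L)"
    have K': "finite K'" "K' \<subseteq> K" using L'(1) \<kappa> by (auto simp: K'_def)
    have "L' \<subseteq> L \<union> invariance_constraints K'"
      using \<kappa> unfolding K'_def invariance_constraints_def by blast
    then have "prob_constrained (L \<union> invariance_constraints K') \<subseteq> prob_constrained L'"
      by (rule prob_constrained_antimono)
    moreover have "prob_constrained (L \<union> invariance_constraints K') \<noteq> {}"
      using fin[OF K'] K K' by (subst prob_constrained_invariance) auto
    ultimately show "prob_constrained L' \<noteq> {}" by blast
  qed
  then show ?thesis using K by (subst (asm) prob_constrained_invariance) auto
qed

section \<open>Bounded orbits of integer matrices\<close>

lemma affine_bounded_imp_zero:
  fixes a b :: "'a::real_normed_vector"
  assumes "\<And>n. norm (a + real n *\<^sub>R b) \<le> C" shows "b = 0"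
proof (rule ccontr)
  assume "b \<noteq> 0"
  then obtain n where n: "C + norm a < real n * norm b"
    using reals_Archimedean3[of "norm b"] by auto
  have "real n * norm b = norm (real n *\<^sub>R b)" by simp
  also have "\<dots> \<le> norm (a + real n *\<^sub>R b) + norm a"
    using norm_triangle_ineq4[of "a + real n *\<^sub>R b" a] by simp
  finally show False using assms[of n] n by linarith
qed

lemma arithmetic_progression:
  fixes y :: "nat \<Rightarrow> 'a::real_vector"
  assumes "\<And>n. y (Suc n) = y n + d" shows "y n = y 0 + real n *\<^sub>R d"
  by (induction n) (simp_all add: assms scaleR_left_distrib)

lemma real_mat_mult: "real_mat (A ** B) = real_mat A ** real_mat B"
  by (simp add: vec_eq_iff matrix_matrix_mult_def)

lemma real_mat_add: "real_mat (A + B) = real_mat A + real_mat B"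
  by (simp add: vec_eq_iff)

lemma real_mat_one [simp]: "real_mat (mat 1) = mat 1"
  by (simp add: vec_eq_iff mat_def)

text \<open>The equation \<open>A ** A + mat 1 = A + A\<close> says \<open>(A - 1)\<^sup>2 = 0\<close>. A recursion
  \<open>x (n + 1) = A x n + b\<close> then makes \<open>x\<close> quadratic in \<open>n\<close>, hence constant if bounded.\<close>

lemma unipotent_recursion_bounded_const:
  fixes x :: "nat \<Rightarrow> real^2"
  assumes A: "A ** A + mat 1 = A + A"
    and rec: "\<And>n. x (Suc n) = real_mat A *v x n + b"
    and bdd: "\<And>n. norm (x n) \<le> C"
  shows "x (Suc 0) = x 0"
proof -
  \<comment> \<open>Differencing removes \<open>b\<close>. The matrix equation then says that the
    second differences of \<open>y\<close> vanish, so \<open>y\<close> is an arithmetic progression;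
    boundedness is used first for \<open>y\<close> and then for \<open>x\<close>.\<close>
  define y where "y = (\<lambda>n. x (Suc n) - x n)"
  have yA: "y (Suc n) = real_mat A *v y n" for n
    by (simp add: y_def rec matrix_vector_mult_diff_distrib)
  have "y (Suc (Suc n)) + y n = y (Suc n) + y (Suc n)" for n
  proof -
    have "real_mat (A ** A + mat 1) *v y n = real_mat (A + A) *v y n" by (simp add: A)
    then show ?thesis
      unfolding yA real_mat_add real_mat_mult real_mat_one matrix_vector_mult_add_rdistrib
        matrix_vector_mul_lid matrix_vector_mul_assoc .
  qed
  then have "y (Suc (Suc n)) = y (Suc n) + y (Suc n) - y n" for n by (rule eq_diff_eq[THEN iffD2])
  then have y2: "y (Suc (Suc n)) - y (Suc n) = y (Suc n) - y n" for n by simp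
  have "y (Suc n) - y n = y 1 - y 0" for n
  proof (induction n)
    case (Suc n)
    then show ?case by (simp only: y2)
  qed simp
  then have "y (Suc n) = y n + (y 1 - y 0)" for n by (metis add.commute diff_add_cancel)
  then have yn: "y n = y 0 + real n *\<^sub>R (y 1 - y 0)" for n by (rule arithmetic_progression)
  have "norm (y n) \<le> C + C" for n
    using norm_triangle_ineq4[of "x (Suc n)" "x n"] bdd[of n] bdd[of "Suc n"] by (simp add: y_def)
  then have "norm (y 0 + real n *\<^sub>R (y 1 - y 0)) \<le> C + C" for n by (metis yn)
  then have "y 1 - y 0 = 0" by (rule affine_bounded_imp_zero)
  then have "y n = y 0" for n using yn[of n] by simp
  then have "x (Suc n) - x n = y 0" for n by (simp only: y_def)
  then have "x (Suc n) = x n + y 0" for n by (metis add.commute diff_add_cancel)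
  then have "x n = x 0 + real n *\<^sub>R y 0" for n by (rule arithmetic_progression)
  then have "norm (x 0 + real n *\<^sub>R y 0) \<le> C" for n using bdd by metis
  then have "y 0 = 0" by (rule affine_bounded_imp_zero)
  then show ?thesis by (simp add: y_def)
qed

text \<open>If \<open>cmod c > 1\<close>, a nonzero value grows forward without bound. If
  \<open>cmod c < 1\<close>, then \<open>y m = c ^ n * y (m - n)\<close> with bounded second factor,
  so it is arbitrarily small; expressing \<open>y m\<close> by an earlier value avoids division by
  \<open>c\<close>.\<close>

lemma geometric_bounded_zero:
  fixes y :: "int \<Rightarrow> complex"
  assumes rec: "\<And>m. y (m + 1) = c * y m" and bdd: "\<And>m. cmod (y m) \<le> C" and c: "cmod c \<noteq> 1"
  shows "y m = 0"
proof (rule ccontr)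
  assume y: "y m \<noteq> 0"
  have pow: "y (k + int n) = c ^ n * y k" for k n
  proof (induction n)
    case (Suc n)
    then show ?case using rec[of "k + int n"] by (simp add: algebra_simps)
  qed simp
  show False
  proof (cases "cmod c > 1")
    case True
    then obtain n where "C / cmod (y m) < cmod c ^ n" using real_arch_pow by blast
    then have "C < cmod c ^ n * cmod (y m)" using y by (simp add: field_simps)
    then show False using bdd[of "m + int n"] by (simp add: pow norm_mult norm_power)
  next
    case False
    have "cmod (y m) \<le> cmod c ^ n * C" for n
    proof -
      have "cmod (y m) = cmod c ^ n * cmod (y (m - int n))"
        using pow[of "m - int n" n] by (simp add: norm_mult norm_power)
      then show ?thesis using bdd[of "m - int n"] by (simp add: mult_left_mono)
    qed
    moreover have "(\<lambda>n. cmod c ^ n * C) \<longlonglongrightarrow> 0 * C"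
      using False c by (intro tendsto_intros LIMSEQ_power_zero) auto
    ultimately have "cmod (y m) \<le> 0 * C" by (intro LIMSEQ_le_const[of _ "0 * C"]) auto
    then show False using y by simp
  qed
qed

lemma spec_root:
  fixes A :: "int^2^2" and c :: complex
  assumes "(of_int (A$1$1) - c) * (of_int (A$2$2) - c) = of_int (A$1$2) * of_int (A$2$1)"
  shows "c \<in> spec A"
proof -
  define M :: "complex^2^2" where "M = map_matrix of_int A - mat c"
  have "det M = 0" using assms by (simp add: M_def det_2 mat_def)
  then have "\<not> invertible M" by (simp add: invertible_det_nz)
  then obtain w where w: "w \<noteq> 0" "M *v w = 0"
    using matrix_left_invertible_ker[of M] by (auto simp: invertible_left_inverse)
  have "mat c *v w = c *s w" by (simp add: vec_eq_iff matrix_vector_mult_def mat_def if_distrib[of "\<lambda>x. x * _"] cong: if_cong)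
  then have "map_matrix of_int A *v w = c *s w"
    using w(2) by (simp add: M_def matrix_vector_mult_diff_rdistrib)
  then show ?thesis using w(1) unfolding spec_def by blast
qed

text \<open>By Cayley-Hamilton every coordinate satisfies the scalar recursion with trace
  \<open>t\<close> and determinant \<open>d\<close>. This recursion splits into two geometric ones
  with the eigenvalues \<open>l1\<close>, \<open>l2\<close> as ratios, which also covers a repeated
  eigenvalue without diagonalisation.\<close>

lemma hyperbolic_bounded_orbit_zero:
  fixes x :: "int \<Rightarrow> real^2"
  assumes spec: "\<forall>c \<in> spec A. cmod c \<noteq> 1"
    and rec: "\<And>m. x (m + 1) = real_mat A *v x m" and bdd: "\<And>m. norm (x m) \<le> C"
  shows "x m = 0"
proof -
  define a where "a = (\<lambda>i j. complex_of_int (A $ i $ j))"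
  define t where "t = a 1 1 + a 2 2"
  define d where "d = a 1 1 * a 2 2 - a 1 2 * a 2 1"
  define s where "s = csqrt (t\<^sup>2 - 4 * d)"
  define l1 where "l1 = (t + s) / 2"
  define l2 where "l2 = (t - s) / 2"
  have s2: "s\<^sup>2 = t\<^sup>2 - 4 * d" by (simp add: s_def)
  have lsum: "l1 + l2 = t" by (simp add: l1_def l2_def field_simps)
  have lprod: "l1 * l2 = d"
  proof -
    have "4 * (l1 * l2) = (t + s) * (t - s)" by (simp add: l1_def l2_def)
    also have "\<dots> = t\<^sup>2 - s\<^sup>2" by (simp add: power2_eq_square algebra_simps)
    finally have "4 * (l1 * l2) = t\<^sup>2 - s\<^sup>2" .
    then show ?thesis by (simp add: s2)
  qed
  have root: "(a 1 1 - l) * (a 2 2 - l) = a 1 2 * a 2 1" if "l = l1 \<or> l = l2" for l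
  proof -
    have "l * l - t * l + d = 0"
      using that unfolding lsum[symmetric] lprod[symmetric] by (auto simp: algebra_simps)
    then show ?thesis by (simp add: t_def d_def algebra_simps)
  qed
  have l1: "cmod l1 \<noteq> 1" and l2: "cmod l2 \<noteq> 1"
    using spec spec_root[of A l1] spec_root[of A l2] root unfolding a_def by blast+
  have "x m $ i = 0" for i
  proof -
    define y where "y = (\<lambda>m. complex_of_real (x m $ i))"
    have yb: "cmod (y k) \<le> C" for k
      using component_le_norm_cart[of "x k" i] bdd[of k] by (simp add: y_def)
    have comp: "complex_of_real (x (k + 1) $ j) = a j 1 * of_real (x k $ 1) + a j 2 * of_real (x k $ 2)" for j k
      unfolding rec by (simp add: matrix_vector_mult_def sum_2 a_def)
    have CH: "y (k + 1 + 1) = t * y (k + 1) - d * y k" for k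
      using exhaust_2[of i] unfolding y_def
      by (auto simp only: comp) (simp_all add: t_def d_def algebra_simps)
    \<comment> \<open>Applying one linear factor of the characteristic polynomial leaves a geometric
      sequence with ratio \<open>l1\<close>; once it vanishes, \<open>y\<close> itself is geometric
      with ratio \<open>l2\<close>.\<close>
    define z where "z = (\<lambda>k. y (k + 1) - l2 * y k)"
    have "z (k + 1) = l1 * z k" for k
      unfolding z_def CH lsum[symmetric] lprod[symmetric] by (simp add: algebra_simps)
    moreover have "cmod (z k) \<le> C + cmod l2 * C" for k
      unfolding z_def
      by (intro order_trans[OF norm_triangle_ineq4] add_mono) (auto simp: norm_mult yb mult_left_mono)
    ultimately have "z k = 0" for k using geometric_bounded_zero l1 by blast
    then have "y (k + 1) = l2 * y k" for k by (simp add: z_def)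
    then have "y m = 0" using geometric_bounded_zero yb l2 by blast
    then show ?thesis by (simp add: y_def)
  qed
  then show ?thesis by (simp add: vec_eq_iff)
qed

text \<open>Iterated push-forwards yield sequences indexed by naturals only. A forward orbit of
  \<open>A\<close> and one of its inverse \<open>B\<close>, with common start, are glued into the
  two-sided orbit required above.\<close>

lemma hyperbolic_bounded_orbits_zero:
  fixes u u' :: "nat \<Rightarrow> real^2"
  assumes spec: "\<forall>c \<in> spec A. cmod c \<noteq> 1" and AB: "A ** B = mat 1"
    and u: "\<And>n. u (Suc n) = real_mat A *v u n" "\<And>n. norm (u n) \<le> C"
    and u': "\<And>n. u' (Suc n) = real_mat B *v u' n" "\<And>n. norm (u' n) \<le> C"
    and eq: "u' 0 = u 0"
  shows "u 0 = 0"
proof -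
  define x where "x = (\<lambda>m::int. if m \<ge> 0 then u (nat m) else u' (nat (- m)))"
  have "x (m + 1) = real_mat A *v x m" for m
  proof (cases "m \<ge> 0")
    case True
    then have "nat (m + 1) = Suc (nat m)" by simp
    then show ?thesis using True by (simp add: x_def u)
  next
    case False
    define n where "n = nat (- m - 1)"
    have "x (m + 1) = u' n" using False eq by (auto simp: x_def n_def)
    moreover have "nat (- m) = Suc n" using False by (simp add: n_def)
    then have "x m = real_mat B *v u' n" using False by (simp add: x_def u')
    ultimately show ?thesis
      by (simp add: matrix_vector_mul_assoc AB flip: real_mat_mult)
  qed
  moreover have "norm (x m) \<le> C" for m by (simp add: x_def u u')
  ultimately have "x 0 = 0" by (rule hyperbolic_bounded_orbit_zero[OF spec])
  then show ?thesis by (simp add: x_def)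
qed

section \<open>Rotation vectors\<close>

definition displacement :: "(real^2 \<Rightarrow> real^2) \<Rightarrow> torus \<Rightarrow> real^2" where
  "displacement F p = F (rep_torus p) - rep_torus p"

lemma rotation_vector_displacement: "rotation_vector \<nu> F = (\<integral>p. displacement F p \<partial>\<nu>)"
  by (simp add: rotation_vector_def displacement_def)

lemma inv_prob_iff: "\<nu> \<in> inv_prob f \<longleftrightarrow> prob_borel \<nu> \<and> distr \<nu> borel f = \<nu>"
  by (auto simp: inv_prob_def prob_borel_def)

lemma lift_class_one:
  assumes "is_lift F f" "mapping_class f = mat 1"
  shows "F (x + int_vec v) = F x + int_vec v"
  using lift_class[OF assms(1)] by (simp add: assms(2) is_lift_of_class_def)

lemma displacement_torus_proj:
  assumes "is_lift F f" "mapping_class f = mat 1"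
  shows "displacement F (torus_proj x) = F x - x"
  unfolding displacement_def
  by (rule periodic_rep_torus_proj[of "\<lambda>x. F x - x"]) (simp add: lift_class_one[OF assms])

lemma continuous_on_displacement:
  assumes "is_lift F f" "mapping_class f = mat 1"
  shows "continuous_on UNIV (displacement F)"
  unfolding displacement_def
  by (rule continuous_on_periodic_torus[of "\<lambda>x. F x - x"])
    (use assms in \<open>auto simp: lift_class_one[OF assms] is_lift_def intro!: continuous_intros\<close>)

lemma rotation_vector_bounded:
  assumes "is_lift F f" "mapping_class f = mat 1"
  obtains C where "\<And>\<nu>. prob_borel \<nu> \<Longrightarrow> norm (rotation_vector \<nu> F) \<le> C"
proof -
  obtain C where C: "\<And>p. norm (displacement F p) \<le> C"
    using continuous_torus_bounded[OF continuous_on_displacement[OF assms]] by blast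
  have "norm (rotation_vector \<nu> F) \<le> C" if \<nu>: "prob_borel \<nu>" for \<nu>
  proof -
    interpret prob_space \<nu> using \<nu> by (simp add: prob_borel_def)
    have c: "continuous_on UNIV (\<lambda>p. norm (displacement F p))"
      using continuous_on_displacement[OF assms] by (rule continuous_on_norm)
    have "norm (rotation_vector \<nu> F) \<le> (\<integral>p. norm (displacement F p) \<partial>\<nu>)"
      unfolding rotation_vector_displacement by (rule integral_norm_bound)
    also have "\<dots> \<le> (\<integral>p. C \<partial>\<nu>)"
      using C by (intro integral_mono continuous_torus_integrable[OF c \<nu>]) auto
    finally show ?thesis by (simp add: prob_space)
  qed
  then show ?thesis by (rule that)
qed

lemma rotation_vector_nth:
  assumes "is_lift F f" "mapping_class f = mat 1" "prob_borel \<nu>"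
  shows "rotation_vector \<nu> F $ i = (\<integral>p. displacement F p $ i \<partial>\<nu>)"
  unfolding rotation_vector_displacement
  by (rule integral_bounded_linear[OF bounded_linear_vec_nth, symmetric])
    (rule continuous_torus_integrable[OF continuous_on_displacement[OF assms(1,2)] assms(3)])

text \<open>A lift of the identity is an integer translation. This is the base case, at the trivial
  end of the central series, of both inductions on rotation vectors.\<close>

lemma rotation_vector_lift_id:
  assumes "is_lift F id"
  obtains w where "\<And>\<nu>. prob_borel \<nu> \<Longrightarrow> rotation_vector \<nu> F = w"
proof -
  obtain w where "\<And>x. F x = id x + int_vec w" using lift_unique[OF assms is_lift_id] by blast
  then have "rotation_vector \<nu> F = int_vec w" if "prob_borel \<nu>" for \<nu>
    using that by (simp add: rotation_vector_def prob_borel_def prob_space.prob_space)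
  then show ?thesis by (rule that)
qed

lemma integral_compose_invariant:
  fixes f :: "torus \<Rightarrow> 'a::{banach, second_countable_topology}"
  assumes "\<nu> \<in> inv_prob \<psi>" "continuous_on UNIV \<psi>" "continuous_on UNIV f"
  shows "(\<integral>p. f (\<psi> p) \<partial>\<nu>) = (\<integral>p. f p \<partial>\<nu>)"
  using integral_distr_continuous[of \<nu> \<psi> f] assms by (simp add: inv_prob_iff)

text \<open>The displacement is a cocycle: that of \<open>F \<circ> E\<close> at \<open>p\<close> is
  that of \<open>F\<close> at \<open>\<psi> p\<close> plus that of \<open>E\<close> at
  \<open>p\<close>. Invariance under \<open>\<psi>\<close> removes the shift of the base
  point.\<close>

lemma rotation_vector_compose:
  assumes F: "is_lift F f" "mapping_class f = mat 1"
    and E: "is_lift E \<psi>" "mapping_class \<psi> = mat 1" "continuous_on UNIV \<psi>"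
    and \<nu>: "\<nu> \<in> inv_prob \<psi>"
  shows "rotation_vector \<nu> (F \<circ> E) = rotation_vector \<nu> F + rotation_vector \<nu> E"
proof -
  have p: "prob_borel \<nu>" using \<nu> by (simp add: inv_prob_iff)
  have dF: "continuous_on UNIV (displacement F)" by (rule continuous_on_displacement[OF F])
  have dE: "continuous_on UNIV (displacement E)" by (rule continuous_on_displacement[OF E(1,2)])
  have dFE: "continuous_on UNIV (\<lambda>p. displacement F (\<psi> p))"
    using continuous_on_compose2[OF dF E(3)] by auto
  have "displacement (F \<circ> E) p = displacement F (\<psi> p) + displacement E p" for p
  proof -
    have "torus_proj (E (rep_torus p)) = \<psi> p" using E(1) by (simp add: is_lift_def)
    then show ?thesis
      using displacement_torus_proj[OF F, of "E (rep_torus p)"] by (simp add: displacement_def)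
  qed
  then have "displacement (F \<circ> E) = (\<lambda>p. displacement F (\<psi> p) + displacement E p)" by blast
  then show ?thesis
    unfolding rotation_vector_displacement
    using dFE dE p by (simp add: continuous_torus_integrable integral_compose_invariant[OF \<nu> E(3) dF])
qed

text \<open>Here \<open>\<eta> = z\<inverse> \<circ> \<psi> \<circ> z\<close>; the
  periodic function \<open>Z - A\<close> contributes nothing by \<open>\<eta>\<close>-invariance.\<close>

lemma rotation_vector_distr:
  assumes Z: "is_lift Z z" "continuous_on UNIV z"
    and \<Psi>: "is_lift \<Psi> \<psi>" "mapping_class \<psi> = mat 1"
    and E: "is_lift E \<eta>" "mapping_class \<eta> = mat 1" "continuous_on UNIV \<eta>"
    and conj: "z \<circ> \<eta> = \<psi> \<circ> z"
  obtains w where "\<And>\<nu>. \<nu> \<in> inv_prob \<eta> \<Longrightarrow>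
    rotation_vector (distr \<nu> borel z) \<Psi> = real_mat (mapping_class z) *v rotation_vector \<nu> E + w"
proof -
  let ?A = "real_mat (mapping_class z)"
  have "is_lift (Z \<circ> E) (z \<circ> \<eta>)" "is_lift (\<Psi> \<circ> Z) (z \<circ> \<eta>)"
    using is_lift_compose[OF Z(1) E(1)] is_lift_compose[OF \<Psi>(1) Z(1)] by (simp_all add: conj)
  \<comment> \<open>Both composites lift the same map, so they differ by an integer translation. It
    is fixed before any measure appears, hence the \<open>w\<close> obtained serves all measures at
    once.\<close>
  then obtain v where v: "\<And>x. (\<Psi> \<circ> Z) x = (Z \<circ> E) x + int_vec v" using lift_unique by blast
  define q where "q = (\<lambda>x. Z x - ?A *v x)"
  have per: "q (x + int_vec u) = q x" for x u
    using lift_class[OF Z(1)]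
    by (simp add: q_def is_lift_of_class_def int_vec_matrix_mult matrix_vector_right_distrib)
  have cq: "continuous_on UNIV (\<lambda>p. q (rep_torus p))"
  proof (rule continuous_on_periodic_torus[OF _ per])
    show "continuous_on UNIV q" using Z(1) unfolding q_def is_lift_def
      by (intro continuous_on_diff linear_continuous_on[OF matrix_vector_mul_bounded_linear]) auto
  qed
  have cq\<eta>: "continuous_on UNIV (\<lambda>p. q (rep_torus (\<eta> p)))"
    using continuous_on_compose2[OF cq E(3)] by auto
  have dE: "continuous_on UNIV (displacement E)" by (rule continuous_on_displacement[OF E(1,2)])
  have "displacement \<Psi> (z p) = ?A *v displacement E p + (q (rep_torus (\<eta> p)) - q (rep_torus p)) + int_vec v" for p
  proof -
    define r where "r = rep_torus p"
    have "torus_proj (Z r) = z p" using Z(1) by (simp add: is_lift_def r_def)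
    then have "displacement \<Psi> (z p) = \<Psi> (Z r) - Z r"
      using displacement_torus_proj[OF \<Psi>, of "Z r"] by simp
    also have "\<dots> = Z (E r) + int_vec v - Z r" using v[of r] by simp
    also have "\<dots> = ?A *v (E r - r) + (q (E r) - q r) + int_vec v"
      by (simp add: q_def matrix_vector_mult_diff_distrib)
    also have "q (E r) = q (rep_torus (\<eta> p))"
    proof -
      have "torus_proj (E r) = \<eta> p" using E(1) by (simp add: is_lift_def r_def)
      then show ?thesis using periodic_rep_torus_proj[of q "E r"] per by simp
    qed
    finally show ?thesis by (simp add: displacement_def r_def)
  qed note disp = this
  have "rotation_vector (distr \<nu> borel z) \<Psi> = ?A *v rotation_vector \<nu> E + int_vec v"
    if \<nu>: "\<nu> \<in> inv_prob \<eta>" for \<nu>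
  proof -
    have p: "prob_borel \<nu>" using \<nu> by (simp add: inv_prob_iff)
    interpret prob_space \<nu> using p by (simp add: prob_borel_def)
    have iE: "integrable \<nu> (displacement E)" by (rule continuous_torus_integrable[OF dE p])
    have iq: "integrable \<nu> (\<lambda>p. q (rep_torus p))" by (rule continuous_torus_integrable[OF cq p])
    have iq\<eta>: "integrable \<nu> (\<lambda>p. q (rep_torus (\<eta> p)))" by (rule continuous_torus_integrable[OF cq\<eta> p])
    have iA: "integrable \<nu> (\<lambda>p. ?A *v displacement E p)"
      by (rule integrable_bounded_linear[OF matrix_vector_mul_bounded_linear iE])
    have "rotation_vector (distr \<nu> borel z) \<Psi> = (\<integral>p. displacement \<Psi> (z p) \<partial>\<nu>)"
      unfolding rotation_vector_displacement
      by (rule integral_distr_continuous[OF p Z(2) continuous_on_displacement[OF \<Psi>]])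
    also have "\<dots> = (\<integral>p. ?A *v displacement E p \<partial>\<nu>) +
        ((\<integral>p. q (rep_torus (\<eta> p)) \<partial>\<nu>) - (\<integral>p. q (rep_torus p) \<partial>\<nu>)) + int_vec v"
      unfolding disp using iA iq iq\<eta> by (simp add: prob_space)
    also have "(\<integral>p. q (rep_torus (\<eta> p)) \<partial>\<nu>) = (\<integral>p. q (rep_torus p) \<partial>\<nu>)"
      by (rule integral_compose_invariant[OF \<nu> E(3) cq])
    also have "(\<integral>p. ?A *v displacement E p \<partial>\<nu>) = ?A *v rotation_vector \<nu> E"
      unfolding rotation_vector_displacement
      by (rule integral_bounded_linear[OF matrix_vector_mul_bounded_linear iE])
    finally show ?thesis by simp
  qed
  then show ?thesis by (rule that)
qed

section \<open>Climbing a central series\<close>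

text \<open>The notation \<open>inv\<close> is taken by the group inverse of HOL-Algebra.\<close>

abbreviation (input) hinv :: "(torus \<Rightarrow> torus) \<Rightarrow> torus \<Rightarrow> torus" where
  "hinv f \<equiv> inv_into UNIV f"

definition homeo_group :: "(torus \<Rightarrow> torus) set \<Rightarrow> bool" where
  "homeo_group G \<longleftrightarrow> (\<forall>g\<in>G. is_homeo g \<and> hinv g \<in> G) \<and> id \<in> G \<and> (\<forall>g\<in>G. \<forall>h\<in>G. g \<circ> h \<in> G)"

text \<open>Stated on plain functions and with commutators only, so that the form passes to
  intersections with the subgroup of trivial classes.\<close>

definition central_series :: "(torus \<Rightarrow> torus) set \<Rightarrow> (nat \<Rightarrow> (torus \<Rightarrow> torus) set) \<Rightarrow> nat \<Rightarrow> bool" where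
  "central_series G \<Gamma> n \<longleftrightarrow> homeo_group G \<and> \<Gamma> 0 = G \<and> \<Gamma> n = {id} \<and>
     (\<forall>i. \<Gamma> i \<subseteq> G \<and> (\<forall>x \<in> \<Gamma> i. hinv x \<in> \<Gamma> i \<and> (\<forall>g\<in>G. x \<circ> g \<circ> hinv x \<circ> hinv g \<in> \<Gamma> (Suc i))))"

lemma homeo_inv:
  assumes "is_homeo g" shows "g \<circ> hinv g = id" "hinv g \<circ> g = id" "bij g"
proof -
  show b: "bij g"
    using assms by (auto simp: is_homeo_def homeomorphism_def intro: o_bij simp: fun_eq_iff)
  show "g \<circ> hinv g = id" using bij_is_surj[OF b] by (auto simp: fun_eq_iff surj_f_inv_f)
  show "hinv g \<circ> g = id" using bij_is_inj[OF b] by (auto simp: fun_eq_iff)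
qed

lemma homeo_inv_apply:
  assumes "is_homeo g" shows "g (hinv g x) = x" "hinv g (g x) = x"
  using homeo_inv(1,2)[OF assms] by (metis comp_apply id_apply)+

lemma homeo_groupD:
  assumes "homeo_group G" "g \<in> G"
  shows "is_homeo g" "continuous_on UNIV g" "hinv g \<in> G"
  using assms by (auto simp: homeo_group_def is_homeo_continuous)

lemma homeo_group_comp: "homeo_group G \<Longrightarrow> g \<in> G \<Longrightarrow> h \<in> G \<Longrightarrow> g \<circ> h \<in> G"
  by (auto simp: homeo_group_def)

lemma mapping_class_comp:
  "homeo_group G \<Longrightarrow> g \<in> G \<Longrightarrow> h \<in> G \<Longrightarrow> mapping_class (g \<circ> h) = mapping_class g ** mapping_class h"
  by (simp add: mapping_class_compose homeo_groupD)

lemma mapping_class_inv: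
  assumes "homeo_group G" "g \<in> G"
  shows "mapping_class g ** mapping_class (hinv g) = mat 1" "mapping_class (hinv g) ** mapping_class g = mat 1"
  using mapping_class_comp[OF assms(1)] homeo_groupD[OF assms] homeo_inv[OF homeo_groupD(1)[OF assms]]
    assms(2) mapping_class_id by metis+

lemma mapping_class_conj_one:
  assumes "homeo_group G" "g \<in> G" "h \<in> G" "mapping_class h = mat 1"
  shows "mapping_class (hinv g \<circ> h \<circ> g) = mat 1"
  using assms mapping_class_inv[OF assms(1,2)]
  by (simp add: mapping_class_comp homeo_group_comp homeo_groupD)

lemma commutator_in_central_series:
  assumes "central_series G \<Gamma> n" "x \<in> \<Gamma> i" "g \<in> G"
  shows "x \<circ> g \<circ> hinv x \<circ> hinv g \<in> \<Gamma> (Suc i)" "g \<circ> x \<circ> hinv g \<circ> hinv x \<in> \<Gamma> (Suc i)"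
proof -
  show 1: "x \<circ> g \<circ> hinv x \<circ> hinv g \<in> \<Gamma> (Suc i)" using assms by (auto simp: central_series_def)
  have "x \<in> G" "homeo_group G" using assms unfolding central_series_def by blast+
  then have hom: "is_homeo x" "is_homeo g" using assms(3) homeo_groupD(1) by blast+
  have "hinv (x \<circ> g \<circ> hinv x \<circ> hinv g) = g \<circ> x \<circ> hinv g \<circ> hinv x"
    by (rule inv_unique_comp) (simp_all add: fun_eq_iff homeo_inv_apply hom)
  then show "g \<circ> x \<circ> hinv g \<circ> hinv x \<in> \<Gamma> (Suc i)"
    using 1 assms(1) unfolding central_series_def by metis
qed

lemma distr_comp_continuous:
  assumes "prob_borel \<nu>" "continuous_on UNIV g" "continuous_on UNIV h"
  shows "distr (distr \<nu> borel h) borel g = distr \<nu> borel (g \<circ> h)"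
  by (rule distr_distr[OF borel_measurable_continuous_onI[OF assms(2)] continuous_torus_measurable[OF assms(3,1)]])

text \<open>Modulo \<open>\<Gamma> (i + 1)\<close> the elements of \<open>\<Gamma> i\<close> are central, so they act on the measures
  invariant under \<open>\<Gamma> (i + 1)\<close>, and they act by commuting maps.\<close>

lemma distr_central_commute:
  assumes C: "central_series G \<Gamma> n" and z: "z \<in> \<Gamma> i" and k: "k \<in> G"
    and \<nu>: "prob_borel \<nu>" "\<And>c. c \<in> \<Gamma> (Suc i) \<Longrightarrow> distr \<nu> borel c = \<nu>"
  shows "distr (distr \<nu> borel z) borel k = distr (distr \<nu> borel k) borel z"
proof -
  have G: "homeo_group G" and zG: "z \<in> G" and iz: "hinv z \<in> \<Gamma> i"
    using C z by (auto simp: central_series_def)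
  \<comment> \<open>The commutator with \<open>k \<circ> z = z \<circ> k \<circ> c\<close>: here
    \<open>c\<close> acts first, directly on \<open>\<nu>\<close>, and is absorbed by
    invariance.\<close>
  define c where "c = hinv k \<circ> hinv z \<circ> hinv (hinv k) \<circ> hinv (hinv z)"
  have c: "c \<in> \<Gamma> (Suc i)"
    unfolding c_def by (rule commutator_in_central_series(2)[OF C iz homeo_groupD(3)[OF G k]])
  then have cG: "c \<in> G" using C by (auto simp: central_series_def)
  note h = homeo_groupD(1)[OF G zG] homeo_groupD(1)[OF G k]
  note ct = homeo_groupD(2)[OF G]
  have "c = hinv k \<circ> hinv z \<circ> k \<circ> z"
    unfolding c_def using h by (simp add: homeo_inv(3) inv_inv_eq)
  then have "k \<circ> z = z \<circ> k \<circ> c" using h by (simp add: fun_eq_iff homeo_inv_apply)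
  then have "distr (distr \<nu> borel z) borel k = distr \<nu> borel (z \<circ> k \<circ> c)"
    by (simp only: distr_comp_continuous[OF \<nu>(1) ct[OF k] ct[OF zG]])
  also have "\<dots> = distr (distr \<nu> borel c) borel (z \<circ> k)"
    by (rule distr_comp_continuous[OF \<nu>(1) ct[OF homeo_group_comp[OF G zG k]] ct[OF cG], symmetric])
  also have "\<dots> = distr (distr \<nu> borel k) borel z"
    by (simp only: \<nu>(2)[OF c] distr_comp_continuous[OF \<nu>(1) ct[OF zG] ct[OF k]])
  finally show ?thesis .
qed

text \<open>Downward induction from \<open>\<Gamma> n = {id}\<close> to
  \<open>\<Gamma> 0 = G\<close>. At level \<open>i\<close> the fixed point theorem is applied to
  \<open>\<Gamma> i\<close> on the measures that satisfy \<open>L\<close> and are invariant under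
  \<open>H\<close> and \<open>\<Gamma> (Suc i)\<close>. Centrality supplies commutation and the
  stability of invariance; the stability of \<open>L\<close> is the hypothesis
  \<open>pres\<close>.\<close>

lemma central_series_fixed_point:
  assumes C: "central_series G \<Gamma> n" and H: "H \<subseteq> G"
    and cont: "\<And>f c. (f, c) \<in> L \<Longrightarrow> continuous_on UNIV f"
    and pres: "\<And>i z \<nu>. z \<in> \<Gamma> i \<Longrightarrow> \<nu> \<in> prob_constrained L \<Longrightarrow>
      \<nu> \<in> inv_prob_group (H \<union> \<Gamma> (Suc i)) \<Longrightarrow> distr \<nu> borel z \<in> prob_constrained L"
    and start: "\<nu>0 \<in> prob_constrained L" "\<nu>0 \<in> inv_prob_group H"
  shows "\<exists>\<nu> \<in> prob_constrained L. \<nu> \<in> inv_prob_group G"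
proof -
  have G: "homeo_group G" and \<Gamma>G: "\<And>i. \<Gamma> i \<subseteq> G" and \<Gamma>0: "\<Gamma> 0 = G" and \<Gamma>n: "\<Gamma> n = {id}"
    using C by (auto simp: central_series_def)
  have "\<exists>\<nu> \<in> prob_constrained L. \<forall>k \<in> H \<union> \<Gamma> (n - j). distr \<nu> borel k = \<nu>" if "j \<le> n" for j
    using that
  proof (induction j)
    case 0
    have "distr \<nu>0 borel id = \<nu>0"
      using start(1) by (auto simp: prob_constrained_def prob_borel_def id_def intro!: distr_id2)
    then show ?case using start by (auto simp: \<Gamma>n inv_prob_group_def inv_prob_iff)
  next
    case (Suc j)
    define i where "i = n - Suc j"
    have Si: "n - j = Suc i" using Suc.prems by (simp add: i_def)
    let ?K = "H \<union> \<Gamma> (Suc i)"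
    let ?L = "L \<union> invariance_constraints ?K"
    have KG: "?K \<subseteq> G" using H \<Gamma>G by blast
    have Kc: "continuous_on UNIV k" if "k \<in> ?K" for k using that KG homeo_groupD[OF G] by blast
    have eq: "prob_constrained ?L = {\<nu> \<in> prob_constrained L. \<forall>k\<in>?K. distr \<nu> borel k = \<nu>}"
      using Kc by (rule prob_constrained_invariance)
    have "\<exists>\<nu> \<in> prob_constrained ?L. \<forall>k\<in>\<Gamma> i. distr \<nu> borel k = \<nu>"
    proof (rule markov_kakutani_torus)
      show "continuous_on UNIV f" if fc: "(f, c) \<in> ?L" for f c
      proof (cases "(f, c) \<in> L")
        case False
        then show ?thesis
          using fc Kc continuous_on_invariance_constraints by blast
      qed (rule cont)
      show "prob_constrained ?L \<noteq> {}" using Suc unfolding eq Si by auto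
      show "continuous_on UNIV k" if "k \<in> \<Gamma> i" for k using that \<Gamma>G homeo_groupD[OF G] by blast
    next
      fix k \<nu> assume k: "k \<in> \<Gamma> i" and \<nu>: "\<nu> \<in> prob_constrained ?L"
      then have \<nu>': "\<nu> \<in> prob_constrained L" "prob_borel \<nu>" "\<And>c. c \<in> ?K \<Longrightarrow> distr \<nu> borel c = \<nu>"
        unfolding eq by (auto simp: prob_constrained_def)
      then have "distr \<nu> borel k \<in> prob_constrained L"
        using k by (intro pres[of k i]) (auto simp: inv_prob_group_def inv_prob_iff)
      moreover have "distr (distr \<nu> borel k) borel h = distr \<nu> borel k" if "h \<in> ?K" for h
        using distr_central_commute[OF C k _ \<nu>'(2)] \<nu>'(3) that KG by (metis UnI2 subsetD)
      ultimately show "distr \<nu> borel k \<in> prob_constrained ?L" unfolding eq by blast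
    next
      fix k k' \<nu> assume k: "k \<in> \<Gamma> i" "k' \<in> \<Gamma> i" and \<nu>: "\<nu> \<in> prob_constrained ?L"
      then have \<nu>': "prob_borel \<nu>" "\<And>c. c \<in> ?K \<Longrightarrow> distr \<nu> borel c = \<nu>"
        unfolding eq by (auto simp: prob_constrained_def)
      show "distr (distr \<nu> borel k) borel k' = distr (distr \<nu> borel k') borel k"
        using k \<Gamma>G \<nu>' by (intro distr_central_commute[OF C, of k i]) auto
    qed
    then show ?case unfolding eq by (auto simp: i_def)
  qed
  from this[of n] obtain \<nu> where "\<nu> \<in> prob_constrained L" "\<forall>k \<in> G. distr \<nu> borel k = \<nu>"
    by (auto simp: \<Gamma>0)
  then show ?thesis by (auto simp: inv_prob_group_def inv_prob_iff prob_constrained_def intro!: bexI[of _ \<nu>])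
qed

section \<open>Push-forward and rotation vectors\<close>

lemma distr_funpow_inv_prob_group:
  assumes "prob_borel \<nu>" "\<nu> \<in> inv_prob_group K" "continuous_on UNIV z"
    and "\<And>\<nu>. prob_borel \<nu> \<Longrightarrow> \<nu> \<in> inv_prob_group K \<Longrightarrow> distr \<nu> borel z \<in> inv_prob_group K"
  shows "prob_borel (((\<lambda>\<nu>. distr \<nu> borel z) ^^ m) \<nu>)"
    and "((\<lambda>\<nu>. distr \<nu> borel z) ^^ m) \<nu> \<in> inv_prob_group K"
  using assms by (induction m) (auto intro: prob_borel_distr)

text \<open>The transformation rule is applied to the conjugate \<open>z^-1 \<psi> z\<close>,
  written as \<open>\<kappa> \<circ> \<psi>\<close> with \<open>\<kappa>\<close> deeper in the
  series. Conjugate and \<open>\<psi>\<close> have trivial class, hence so has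
  \<open>\<kappa>\<close>, and the rotation vector of the product splits.\<close>

lemma rotation_vector_distr_commutator:
  assumes G: "homeo_group G" and z: "z \<in> G" and \<psi>: "\<psi> \<in> G" "mapping_class \<psi> = mat 1"
    and F: "is_lift F \<psi>"
  defines "\<kappa> \<equiv> hinv z \<circ> \<psi> \<circ> hinv (hinv z) \<circ> hinv \<psi>"
  obtains E w where "is_lift E \<kappa>" "mapping_class \<kappa> = mat 1"
    "\<And>\<nu>. \<nu> \<in> inv_prob \<kappa> \<Longrightarrow> \<nu> \<in> inv_prob \<psi> \<Longrightarrow> rotation_vector (distr \<nu> borel z) F =
       real_mat (mapping_class z) *v (rotation_vector \<nu> E + rotation_vector \<nu> F) + w"
proof -
  note GD = homeo_groupD[OF G]
  have hz: "hinv (hinv z) = z" using homeo_inv(3)[OF GD(1)[OF z]] by (rule inv_inv_eq)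
  have \<kappa>G: "\<kappa> \<in> G"
    unfolding \<kappa>_def using z \<psi> GD homeo_group_comp[OF G] by auto
  have conj: "\<kappa> \<circ> \<psi> = hinv z \<circ> \<psi> \<circ> z"
    unfolding \<kappa>_def hz using GD(1)[OF \<psi>(1)] by (simp add: fun_eq_iff homeo_inv_apply)
  then have z\<kappa>: "z \<circ> (\<kappa> \<circ> \<psi>) = \<psi> \<circ> z"
    using GD(1)[OF z] by (simp add: fun_eq_iff homeo_inv_apply)
  have \<kappa>\<psi>: "mapping_class (\<kappa> \<circ> \<psi>) = mat 1"
    unfolding conj by (rule mapping_class_conj_one[OF G z \<psi>])
  then have \<kappa>1: "mapping_class \<kappa> = mat 1"
    using mapping_class_comp[OF G \<kappa>G \<psi>(1)] \<psi>(2) by simp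
  obtain E where E: "is_lift E \<kappa>" using lift_exists GD(2)[OF \<kappa>G] by blast
  obtain Z where Z: "is_lift Z z" using lift_exists GD(2)[OF z] by blast
  obtain w where w: "\<And>\<nu>. \<nu> \<in> inv_prob (\<kappa> \<circ> \<psi>) \<Longrightarrow> rotation_vector (distr \<nu> borel z) F =
       real_mat (mapping_class z) *v rotation_vector \<nu> (E \<circ> F) + w"
    using rotation_vector_distr[OF Z GD(2)[OF z] F \<psi>(2) is_lift_compose[OF E F] \<kappa>\<psi> _ z\<kappa>]
      GD(2) homeo_group_comp[OF G \<kappa>G \<psi>(1)] by blast
  show ?thesis
  proof (rule that[OF E \<kappa>1, of w])
    fix \<nu> assume \<nu>: "\<nu> \<in> inv_prob \<kappa>" "\<nu> \<in> inv_prob \<psi>"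
    then have "\<nu> \<in> inv_prob (\<kappa> \<circ> \<psi>)"
      using distr_comp_continuous[of \<nu> \<kappa> \<psi>] GD(2) \<kappa>G \<psi>(1) by (simp add: inv_prob_iff)
    then show "rotation_vector (distr \<nu> borel z) F =
       real_mat (mapping_class z) *v (rotation_vector \<nu> E + rotation_vector \<nu> F) + w"
      using w rotation_vector_compose[OF E \<kappa>1 F \<psi>(2) GD(2)[OF \<psi>(1)] \<nu>(2)] by simp
  qed
qed

text \<open>The level \<open>i\<close> of \<open>z\<close> stays fixed while \<open>j\<close>, the
  depth of \<open>\<psi>\<close>, decreases from \<open>n\<close>. The measure is kept arbitrary so
  that the induction hypothesis for \<open>\<kappa>\<close> applies at every point of the orbit of
  \<open>\<nu>\<close>; this makes the inhomogeneous term constant.\<close>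

lemma rotation_vector_distr_unipotent:
  assumes C: "central_series G \<Gamma> n" and H: "H \<subseteq> G"
    and U: "\<And>g. g \<in> G \<Longrightarrow> mapping_class g ** mapping_class g + mat 1 = mapping_class g + mapping_class g"
    and z: "z \<in> \<Gamma> i" and j: "j \<le> n"
  shows "\<psi> \<in> H \<union> \<Gamma> (Suc i) \<Longrightarrow> \<psi> \<in> \<Gamma> j \<Longrightarrow> mapping_class \<psi> = mat 1 \<Longrightarrow> is_lift F \<psi> \<Longrightarrow>
     prob_borel \<nu> \<Longrightarrow> \<nu> \<in> inv_prob_group (H \<union> \<Gamma> (Suc i)) \<Longrightarrow>
     rotation_vector (distr \<nu> borel z) F = rotation_vector \<nu> F"
  using j
proof (induction j arbitrary: \<psi> F \<nu> rule: inc_induct)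
  have G: "homeo_group G" and \<Gamma>G: "\<And>i. \<Gamma> i \<subseteq> G" and \<Gamma>n: "\<Gamma> n = {id}" and iz: "hinv z \<in> \<Gamma> i"
    using C z by (auto simp: central_series_def)
  note GD = homeo_groupD[OF G]
  have zG: "z \<in> G" using z \<Gamma>G by blast
  {
    case base
    have "\<psi> = id" using base \<Gamma>n by blast
    then have "is_lift F id" using base by metis
    then obtain w where "\<And>\<nu>. prob_borel \<nu> \<Longrightarrow> rotation_vector \<nu> F = w"
      using rotation_vector_lift_id by blast
    then show ?case using base prob_borel_distr GD(2)[OF zG] by simp
  next
    case (step j)
    let ?K = "H \<union> \<Gamma> (Suc i)"
    have KG: "?K \<subseteq> G" using H \<Gamma>G by blast
    have act: "distr \<nu> borel z \<in> inv_prob_group ?K"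
      if \<nu>: "prob_borel \<nu>" "\<nu> \<in> inv_prob_group ?K" for \<nu>
    proof -
      have inv: "distr \<nu> borel c = \<nu>" if "c \<in> ?K" for c
        using \<nu>(2) that by (auto simp: inv_prob_group_def inv_prob_iff)
      have "distr (distr \<nu> borel z) borel k = distr \<nu> borel z" if "k \<in> ?K" for k
        using distr_central_commute[OF C z _ \<nu>(1)] inv that KG by (metis UnI2 subsetD)
      then show ?thesis
        using prob_borel_distr[OF \<nu>(1) GD(2)[OF zG]] by (auto simp: inv_prob_group_def inv_prob_iff)
    qed
    define \<nu>' where "\<nu>' = (\<lambda>m. ((\<lambda>\<nu>. distr \<nu> borel z) ^^ m) \<nu>)"
    have \<nu>': "prob_borel (\<nu>' m)" "\<nu>' m \<in> inv_prob_group ?K" for m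
      unfolding \<nu>'_def using step.prems act GD(2)[OF zG]
      by (intro distr_funpow_inv_prob_group; blast)+
    have \<psi>G: "\<psi> \<in> G" using step.prems KG by blast
    define \<kappa> where "\<kappa> = hinv z \<circ> \<psi> \<circ> hinv (hinv z) \<circ> hinv \<psi>"
    \<comment> \<open>Membership at level \<open>Suc i\<close>, from \<open>z\<close>, gives
      \<open>\<kappa>\<close>-invariance of the measures; membership at level \<open>Suc j\<close>,
      from \<open>\<psi>\<close>, gives access to the induction hypothesis.\<close>
    have \<kappa>i: "\<kappa> \<in> \<Gamma> (Suc i)"
      unfolding \<kappa>_def by (rule commutator_in_central_series(1)[OF C iz \<psi>G])
    have \<kappa>j: "\<kappa> \<in> \<Gamma> (Suc j)"
      unfolding \<kappa>_def using commutator_in_central_series(2)[OF C step.prems(2) GD(3)[OF zG]] .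
    obtain E w where E: "is_lift E \<kappa>" "mapping_class \<kappa> = mat 1"
      and w: "\<And>\<nu>. \<nu> \<in> inv_prob \<kappa> \<Longrightarrow> \<nu> \<in> inv_prob \<psi> \<Longrightarrow> rotation_vector (distr \<nu> borel z) F =
       real_mat (mapping_class z) *v (rotation_vector \<nu> E + rotation_vector \<nu> F) + w"
      using rotation_vector_distr_commutator[OF G zG \<psi>G step.prems(3,4)] unfolding \<kappa>_def by blast
    have "rotation_vector (\<nu>' m) E = rotation_vector (\<nu>' 0) E" for m
    proof (induction m)
      case (Suc m)
      have "rotation_vector (distr (\<nu>' m) borel z) E = rotation_vector (\<nu>' m) E"
        using step.IH[OF _ \<kappa>j E(2,1) \<nu>'] \<kappa>i by blast
      then show ?case using Suc by (simp add: \<nu>'_def)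
    qed simp
    moreover have "\<nu>' m \<in> inv_prob \<kappa>" "\<nu>' m \<in> inv_prob \<psi>" for m
      using \<nu>'(2)[of m] \<kappa>i step.prems(1) unfolding inv_prob_group_def by blast+
    ultimately have "rotation_vector (\<nu>' (Suc m)) F = real_mat (mapping_class z) *v rotation_vector (\<nu>' m) F +
       (real_mat (mapping_class z) *v rotation_vector (\<nu>' 0) E + w)" for m
      using w[of "\<nu>' m"] by (simp add: \<nu>'_def matrix_vector_right_distrib)
    moreover obtain B where "\<And>\<nu>. prob_borel \<nu> \<Longrightarrow> norm (rotation_vector \<nu> F) \<le> B"
      using rotation_vector_bounded[OF step.prems(4,3)] by blast
    then have "norm (rotation_vector (\<nu>' m) F) \<le> B" for m using \<nu>' by blast
    ultimately have "rotation_vector (\<nu>' (Suc 0)) F = rotation_vector (\<nu>' 0) F"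
      by (rule unipotent_recursion_bounded_const[OF U[OF zG]])
    then show ?case by (simp add: \<nu>'_def)
  }
qed

text \<open>For two \<open>K\<close>-invariant measures the contributions of \<open>\<kappa>\<close>
  agree by induction, and the constant \<open>w\<close> cancels. The difference of the rotation
  vectors of \<open>\<psi>\<close> thus follows the linear recursion of the class of
  \<open>a\<close>.\<close>

lemma rotation_vector_hyperbolic_unique:
  assumes C: "central_series G \<Gamma> n" and a: "a \<in> G"
    and spec: "\<forall>c \<in> spec (mapping_class a). cmod c \<noteq> 1"
  defines "K \<equiv> {g \<in> G. mapping_class g = mat 1}"
  assumes j: "j \<le> n" and \<nu>1: "\<nu>1 \<in> inv_prob_group K" and \<nu>2: "\<nu>2 \<in> inv_prob_group K"
  shows "\<psi> \<in> K \<Longrightarrow> \<psi> \<in> \<Gamma> j \<Longrightarrow> is_lift F \<psi> \<Longrightarrow> rotation_vector \<nu>1 F = rotation_vector \<nu>2 F"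
  using j \<nu>1 \<nu>2
proof (induction j arbitrary: \<psi> F \<nu>1 \<nu>2 rule: inc_induct)
  have G: "homeo_group G" and \<Gamma>n: "\<Gamma> n = {id}" using C by (auto simp: central_series_def)
  note GD = homeo_groupD[OF G]
  have idK: "id \<in> K" using G by (simp add: K_def homeo_group_def mapping_class_id)
  have prob: "prob_borel \<nu>" if "\<nu> \<in> inv_prob_group K" for \<nu>
    using that idK by (auto simp: inv_prob_group_def inv_prob_iff)
  {
    case base
    have "\<psi> = id" using base \<Gamma>n by blast
    then have "is_lift F id" using base by metis
    then obtain w where "\<And>\<nu>. prob_borel \<nu> \<Longrightarrow> rotation_vector \<nu> F = w"
      using rotation_vector_lift_id by blast
    then show ?case using base prob by simp
  next
    case (step j)
    have \<psi>: "\<psi> \<in> G" "mapping_class \<psi> = mat 1" using step.prems by (auto simp: K_def)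
    obtain B where B: "\<And>\<nu>. prob_borel \<nu> \<Longrightarrow> norm (rotation_vector \<nu> F) \<le> B"
      using rotation_vector_bounded[OF step.prems(3) \<psi>(2)] by blast
    \<comment> \<open>Stated for any \<open>z\<close> because it is used for \<open>a\<close> and
      for its inverse, which give the two halves of the orbit.\<close>
    have orbit: "\<exists>u. u 0 = rotation_vector \<nu>1 F - rotation_vector \<nu>2 F \<and>
        (\<forall>m. u (Suc m) = real_mat (mapping_class z) *v u m) \<and> (\<forall>m. norm (u m) \<le> B + B)"
      if zG: "z \<in> G" for z
    proof -
      have act: "distr \<nu> borel z \<in> inv_prob_group K" if \<nu>: "\<nu> \<in> inv_prob_group K" for \<nu>
      proof -
        \<comment> \<open>Here \<open>z\<close> need not be central modulo a deeper term; normality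
          of \<open>K\<close> does the work, since the conjugate of \<open>k\<close> by
          \<open>z\<close> again has trivial class and fixes \<open>\<nu>\<close>.\<close>
        have "distr (distr \<nu> borel z) borel k = distr \<nu> borel z" if k: "k \<in> K" for k
        proof -
          let ?c = "hinv z \<circ> k \<circ> z"
          have kG: "k \<in> G" using k by (simp add: K_def)
          then have cG: "?c \<in> G" using zG GD homeo_group_comp[OF G] by auto
          moreover have "mapping_class ?c = mat 1"
            using k by (intro mapping_class_conj_one[OF G zG kG]) (simp add: K_def)
          ultimately have c: "distr \<nu> borel ?c = \<nu>"
            using \<nu> by (auto simp: inv_prob_group_def inv_prob_iff K_def)
          have "k \<circ> z = z \<circ> ?c" using GD(1)[OF zG] by (simp add: fun_eq_iff homeo_inv_apply)
          then have "distr (distr \<nu> borel z) borel k = distr (distr \<nu> borel ?c) borel z"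
            using distr_comp_continuous[OF prob[OF \<nu>]] GD(2) kG zG cG by metis
          then show ?thesis by (simp only: c)
        qed
        then show ?thesis
          using prob_borel_distr[OF prob[OF \<nu>] GD(2)[OF zG]] by (auto simp: inv_prob_group_def inv_prob_iff)
      qed
      define \<nu>' where "\<nu>' = (\<lambda>\<nu> m. ((\<lambda>\<nu>. distr \<nu> borel z) ^^ m) \<nu>)"
      have \<nu>': "\<nu>' \<nu> m \<in> inv_prob_group K" if "\<nu> \<in> inv_prob_group K" for \<nu> m
        unfolding \<nu>'_def using that act prob GD(2)[OF zG]
        by (intro distr_funpow_inv_prob_group(2)) blast+
      define \<kappa> where "\<kappa> = hinv z \<circ> \<psi> \<circ> hinv (hinv z) \<circ> hinv \<psi>"
      have \<kappa>j: "\<kappa> \<in> \<Gamma> (Suc j)"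
        unfolding \<kappa>_def using commutator_in_central_series(2)[OF C step.prems(2) GD(3)[OF zG]] .
      obtain E w where E: "is_lift E \<kappa>" "mapping_class \<kappa> = mat 1"
        and w: "\<And>\<nu>. \<nu> \<in> inv_prob \<kappa> \<Longrightarrow> \<nu> \<in> inv_prob \<psi> \<Longrightarrow> rotation_vector (distr \<nu> borel z) F =
         real_mat (mapping_class z) *v (rotation_vector \<nu> E + rotation_vector \<nu> F) + w"
        using rotation_vector_distr_commutator[OF G zG \<psi> step.prems(3)] unfolding \<kappa>_def by blast
      have \<kappa>K: "\<kappa> \<in> K" using \<kappa>j C E(2) by (auto simp: K_def central_series_def)
      have wK: "rotation_vector (distr \<nu> borel z) F =
         real_mat (mapping_class z) *v (rotation_vector \<nu> E + rotation_vector \<nu> F) + w"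
        if "\<nu> \<in> inv_prob_group K" for \<nu>
        using that \<kappa>K step.prems(1) by (intro w) (auto simp: inv_prob_group_def)
      define u where "u = (\<lambda>m. rotation_vector (\<nu>' \<nu>1 m) F - rotation_vector (\<nu>' \<nu>2 m) F)"
      have "u (Suc m) = real_mat (mapping_class z) *v u m" for m
      proof -
        have "rotation_vector (\<nu>' \<nu>1 m) E = rotation_vector (\<nu>' \<nu>2 m) E"
          using step.IH[OF \<kappa>K \<kappa>j E(1)] \<nu>' step.prems by blast
        moreover have "\<nu>' \<nu> (Suc m) = distr (\<nu>' \<nu> m) borel z" for \<nu> by (simp add: \<nu>'_def)
        ultimately show ?thesis
          using wK[OF \<nu>'[OF step.prems(4), of m]] wK[OF \<nu>'[OF step.prems(5), of m]]
          by (simp add: u_def matrix_vector_right_distrib matrix_vector_mult_diff_distrib)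
      qed
      moreover have "norm (u m) \<le> B + B" for m
        unfolding u_def using B prob \<nu>' step.prems
        by (intro order_trans[OF norm_triangle_ineq4] add_mono) auto
      moreover have "u 0 = rotation_vector \<nu>1 F - rotation_vector \<nu>2 F" by (simp add: u_def \<nu>'_def)
      ultimately show ?thesis by blast
    qed
    obtain u where u: "u 0 = rotation_vector \<nu>1 F - rotation_vector \<nu>2 F"
        "\<And>m. u (Suc m) = real_mat (mapping_class a) *v u m" "\<And>m. norm (u m) \<le> B + B"
      using orbit[OF a] by blast
    obtain u' where u': "u' 0 = rotation_vector \<nu>1 F - rotation_vector \<nu>2 F"
        "\<And>m. u' (Suc m) = real_mat (mapping_class (hinv a)) *v u' m" "\<And>m. norm (u' m) \<le> B + B"
      using orbit[OF GD(3)[OF a]] by blast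
    have "u 0 = 0"
      using hyperbolic_bounded_orbits_zero[where u = u and u' = u' and C = "B + B",
        OF spec mapping_class_inv(1)[OF G a] u(2,3) u'(2,3)] u(1) u'(1) by simp
    then show ?case using u(1) by simp
  }
qed

section \<open>Nilpotent groups of torus homeomorphisms\<close>

lemma subgroup_Homeo_torus_homeo_group:
  assumes "subgroup G Homeo_torus"
  shows "homeo_group G"
    and "g \<in> G \<Longrightarrow> inv\<^bsub>Homeo_torus\<lparr>carrier := G\<rparr>\<^esub> g = hinv g"
proof -
  interpret H: group Homeo_torus by (rule group_Homeo_torus)
  interpret S: subgroup G Homeo_torus by (rule assms)
  have hom: "is_homeo g" if "g \<in> G" for g using S.subset that by (auto simp: Homeo_torus_def)
  have inv: "inv\<^bsub>Homeo_torus\<^esub> g = hinv g" if g: "g \<in> G" for g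
  proof (rule H.inv_equality)
    obtain h where h: "homeomorphism UNIV UNIV g h" using hom[OF g] by (auto simp: is_homeo_def)
    then have "hinv g = h"
      by (intro inv_unique_comp) (auto simp: homeomorphism_def fun_eq_iff)
    then show "hinv g \<in> carrier Homeo_torus"
      using homeomorphism_symD[OF h] by (auto simp: Homeo_torus_def is_homeo_def)
    show "hinv g \<otimes>\<^bsub>Homeo_torus\<^esub> g = \<one>\<^bsub>Homeo_torus\<^esub>" "g \<in> carrier Homeo_torus"
      using homeo_inv(2)[OF hom[OF g]] hom[OF g] by (simp_all add: Homeo_torus_def)
  qed
  show "inv\<^bsub>Homeo_torus\<lparr>carrier := G\<rparr>\<^esub> g = hinv g" if "g \<in> G"
    using H.m_inv_consistent[OF assms that] inv[OF that] by simp
  show "homeo_group G"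
    unfolding homeo_group_def
    using hom S.m_inv_closed inv S.one_closed S.m_closed by (auto simp: Homeo_torus_def)
qed

lemma nilpotent_central_series:
  assumes sub: "subgroup G Homeo_torus" and nil: "nilpotent_group (Homeo_torus\<lparr>carrier := G\<rparr>)"
  obtains n where "central_series G (lower_central (Homeo_torus\<lparr>carrier := G\<rparr>)) n"
proof -
  let ?S = "Homeo_torus\<lparr>carrier := G\<rparr>"
  interpret S: group ?S using nil by (simp add: nilpotent_group_def)
  note inv = subgroup_Homeo_torus_homeo_group(2)[OF sub]
  have one: "\<one>\<^bsub>?S\<^esub> = id" and mult: "x \<otimes>\<^bsub>?S\<^esub> y = x \<circ> y" for x y
    by (simp_all add: Homeo_torus_def)
  obtain n where "lower_central ?S n = {\<one>\<^bsub>?S\<^esub>}" using nil by (auto simp: nilpotent_group_def)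
  then have n: "lower_central ?S n = {id}" by (simp only: one)
  have sg: "subgroup (lower_central ?S i) ?S" for i
  proof (induction i)
    case 0 then show ?case using S.subgroup_self by simp
  next
    case (Suc i)
    interpret L: subgroup "lower_central ?S i" ?S by (rule Suc)
    have "h \<otimes>\<^bsub>?S\<^esub> g \<otimes>\<^bsub>?S\<^esub> inv\<^bsub>?S\<^esub> h \<otimes>\<^bsub>?S\<^esub> inv\<^bsub>?S\<^esub> g \<in> carrier ?S"
      if "h \<in> lower_central ?S i" "g \<in> carrier ?S" for h g
      using that(2) L.mem_carrier[OF that(1)] by (intro S.m_closed S.inv_closed)
    then show ?case
      unfolding lower_central.simps by (intro S.generate_is_subgroup) blast
  qed
  have "central_series G (lower_central ?S) n"
    unfolding central_series_def
  proof (intro conjI allI ballI)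
    fix i
    have L: "subgroup (lower_central ?S i) ?S" by (rule sg)
    show LG: "lower_central ?S i \<subseteq> G" using subgroup.subset[OF L] by simp
    fix x assume x: "x \<in> lower_central ?S i"
    show "hinv x \<in> lower_central ?S i"
      using subgroup.m_inv_closed[OF L x] inv LG x by auto
    fix g assume g: "g \<in> G"
    have "x \<otimes>\<^bsub>?S\<^esub> g \<otimes>\<^bsub>?S\<^esub> inv\<^bsub>?S\<^esub> x \<otimes>\<^bsub>?S\<^esub> inv\<^bsub>?S\<^esub> g \<in> lower_central ?S (Suc i)"
      unfolding lower_central.simps using x g by (intro generate.incl) auto
    moreover have "inv\<^bsub>?S\<^esub> x = hinv x" "inv\<^bsub>?S\<^esub> g = hinv g" using inv x LG g by blast+
    ultimately show "x \<circ> g \<circ> hinv x \<circ> hinv g \<in> lower_central ?S (Suc i)"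
      by (simp only: mult)
  qed (simp_all add: subgroup_Homeo_torus_homeo_group(1)[OF sub] n)
  then show ?thesis by (rule that)
qed

text \<open>Lets the unipotent case be run inside the subgroup of trivial classes when
  \<open>G\<close> itself contains hyperbolic ones.\<close>

lemma central_series_class_one:
  assumes C: "central_series G \<Gamma> n"
  defines "K \<equiv> {g \<in> G. mapping_class g = mat 1}"
  shows "central_series K (\<lambda>i. \<Gamma> i \<inter> K) n"
proof -
  have G: "homeo_group G" and \<Gamma>: "\<Gamma> 0 = G" "\<Gamma> n = {id}" "\<And>i. \<Gamma> i \<subseteq> G" "\<And>i x. x \<in> \<Gamma> i \<Longrightarrow> hinv x \<in> \<Gamma> i"
    using C by (auto simp: central_series_def)
  have inv1: "mapping_class (hinv g) = mat 1" if "g \<in> G" "mapping_class g = mat 1" for g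
    using mapping_class_inv(1)[OF G that(1)] that(2) by simp
  have K: "homeo_group K"
    unfolding homeo_group_def
    using homeo_groupD[OF G] inv1 homeo_group_comp[OF G] mapping_class_comp[OF G] G
    by (auto simp: K_def mapping_class_id homeo_group_def)
  have "x \<circ> g \<circ> hinv x \<circ> hinv g \<in> \<Gamma> (Suc i) \<inter> K" if "x \<in> \<Gamma> i \<inter> K" "g \<in> K" for x g i
    using that commutator_in_central_series(1)[OF C, of x i g] homeo_group_comp[OF K] homeo_groupD(3)[OF K]
    by (auto simp: K_def)
  then show ?thesis
    unfolding central_series_def
    using K \<Gamma> inv1 homeo_groupD[OF G] homeo_group_def[of K] by (auto simp: K_def)
qed

text \<open>Constraints are real valued, so each lift contributes one equation per
  coordinate.\<close>

definition rotation_constraints ::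
  "(torus \<Rightarrow> torus) set \<Rightarrow> torus measure \<Rightarrow> ((torus \<Rightarrow> real) \<times> real) set" where
  "rotation_constraints H \<mu> =
     {(\<lambda>p. displacement F p $ i, rotation_vector \<mu> F $ i) | F i. \<exists>\<psi>\<in>H. is_lift F \<psi>}"

lemma prob_constrained_rotation_iff:
  assumes "\<And>\<psi>. \<psi> \<in> H \<Longrightarrow> mapping_class \<psi> = mat 1"
  shows "\<nu> \<in> prob_constrained (rotation_constraints H \<mu>) \<longleftrightarrow>
    prob_borel \<nu> \<and> (\<forall>\<psi>\<in>H. \<forall>F. is_lift F \<psi> \<longrightarrow> rotation_vector \<nu> F = rotation_vector \<mu> F)"
proof -
  have "(\<forall>(f, c) \<in> rotation_constraints H \<mu>. (\<integral>p. f p \<partial>\<nu>) = c) \<longleftrightarrow>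
      (\<forall>\<psi>\<in>H. \<forall>F. is_lift F \<psi> \<longrightarrow> (\<forall>i. (\<integral>p. displacement F p $ i \<partial>\<nu>) = rotation_vector \<mu> F $ i))"
    unfolding rotation_constraints_def by fastforce
  then show ?thesis
    using rotation_vector_nth[OF _ assms] by (auto simp: prob_constrained_def vec_eq_iff)
qed

text \<open>The rotation constraints of \<open>H\<close> survive push-forward by every
  \<open>z\<close> met during the climb, which is what the fixed point scheme demands. Since
  \<open>H\<close> lies in \<open>\<Gamma> 0\<close>, the invariance result is used at depth
  0.\<close>

lemma unipotent_extension:
  assumes C: "central_series G \<Gamma> n" and H: "H \<subseteq> G"
    and H1: "\<And>\<psi>. \<psi> \<in> H \<Longrightarrow> mapping_class \<psi> = mat 1"
    and U: "\<And>g. g \<in> G \<Longrightarrow> mapping_class g ** mapping_class g + mat 1 = mapping_class g + mapping_class g"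
    and \<mu>: "prob_borel \<mu>" "\<mu> \<in> inv_prob_group H"
  shows "\<exists>\<nu> \<in> inv_prob_group G. \<forall>\<psi>\<in>H. \<forall>F. is_lift F \<psi> \<longrightarrow> rotation_vector \<mu> F = rotation_vector \<nu> F"
proof -
  have R: "\<nu> \<in> prob_constrained (rotation_constraints H \<mu>) \<longleftrightarrow>
    prob_borel \<nu> \<and> (\<forall>\<psi>\<in>H. \<forall>F. is_lift F \<psi> \<longrightarrow> rotation_vector \<nu> F = rotation_vector \<mu> F)" for \<nu>
    by (rule prob_constrained_rotation_iff) (rule H1)
  have "\<exists>\<nu> \<in> prob_constrained (rotation_constraints H \<mu>). \<nu> \<in> inv_prob_group G"
  proof (rule central_series_fixed_point[OF C H])
    show "continuous_on UNIV f" if fc: "(f, c) \<in> rotation_constraints H \<mu>" for f c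
    proof -
      obtain F i \<psi> where "f = (\<lambda>p. displacement F p $ i)" "\<psi> \<in> H" "is_lift F \<psi>"
        using fc unfolding rotation_constraints_def by blast
      then show ?thesis using H1 by (auto intro!: continuous_intros continuous_on_displacement)
    qed
    show "distr \<nu> borel z \<in> prob_constrained (rotation_constraints H \<mu>)"
      if z: "z \<in> \<Gamma> i" and \<nu>: "\<nu> \<in> prob_constrained (rotation_constraints H \<mu>)"
        and inv: "\<nu> \<in> inv_prob_group (H \<union> \<Gamma> (Suc i))" for i z \<nu>
    proof -
      have zG: "z \<in> G" and \<Gamma>0: "\<Gamma> 0 = G" and G: "homeo_group G"
        using C z unfolding central_series_def by blast+
      have p: "prob_borel \<nu>"
        and r: "\<And>\<psi> F. \<psi> \<in> H \<Longrightarrow> is_lift F \<psi> \<Longrightarrow> rotation_vector \<nu> F = rotation_vector \<mu> F"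
        using \<nu> unfolding R by blast+
      have "rotation_vector (distr \<nu> borel z) F = rotation_vector \<mu> F"
        if \<psi>: "\<psi> \<in> H" and F: "is_lift F \<psi>" for \<psi> F
      proof -
        have "\<psi> \<in> H \<union> \<Gamma> (Suc i)" "\<psi> \<in> \<Gamma> 0" using \<psi> H \<Gamma>0 by blast+
        from rotation_vector_distr_unipotent[OF C H U z le0 this H1[OF \<psi>] F p inv]
        show ?thesis using r[OF \<psi> F] by simp
      qed
      then show ?thesis
        using prob_borel_distr[OF p homeo_groupD(2)[OF G zG]] unfolding R by blast
    qed
    show "\<mu> \<in> prob_constrained (rotation_constraints H \<mu>)" using \<mu> R by blast
  qed (rule \<mu>)
  then show ?thesis using R by metis
qed

text \<open>Two measures are compared: \<open>\<nu>1\<close>, invariant under \<open>K\<close> with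
  the prescribed rotation vectors, from the unipotent case on trivial classes; and
  \<open>\<nu>\<close>, invariant under \<open>G\<close>, found with no constraint at all. Both are
  \<open>K\<close>-invariant, so uniqueness transfers the rotation vectors to
  \<open>\<nu>\<close>.\<close>

lemma hyperbolic_extension:
  assumes C: "central_series G \<Gamma> n" and H: "H \<subseteq> G"
    and H1: "\<And>\<psi>. \<psi> \<in> H \<Longrightarrow> mapping_class \<psi> = mat 1"
    and a: "a \<in> G" and spec: "\<forall>c \<in> spec (mapping_class a). cmod c \<noteq> 1"
    and \<mu>: "prob_borel \<mu>" "\<mu> \<in> inv_prob_group H"
  shows "\<exists>\<nu> \<in> inv_prob_group G. \<forall>\<psi>\<in>H. \<forall>F. is_lift F \<psi> \<longrightarrow> rotation_vector \<mu> F = rotation_vector \<nu> F"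
proof -
  define K where "K = {g \<in> G. mapping_class g = mat 1}"
  have CK: "central_series K (\<lambda>i. \<Gamma> i \<inter> K) n" unfolding K_def by (rule central_series_class_one[OF C])
  have HK: "H \<subseteq> K" and KG: "K \<subseteq> G" using H H1 by (auto simp: K_def)
  obtain \<nu>1 where \<nu>1: "\<nu>1 \<in> inv_prob_group K"
    and r1: "\<And>\<psi> F. \<psi> \<in> H \<Longrightarrow> is_lift F \<psi> \<Longrightarrow> rotation_vector \<mu> F = rotation_vector \<nu>1 F"
    using unipotent_extension[OF CK HK H1 _ \<mu>] by (auto simp: K_def)
  have "\<exists>\<nu> \<in> prob_constrained {}. \<nu> \<in> inv_prob_group G"
  proof (rule central_series_fixed_point[OF C, of "{}"])
    show "distr \<nu> borel z \<in> prob_constrained {}" if "z \<in> \<Gamma> i" "\<nu> \<in> prob_constrained {}" for z i \<nu>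
    proof -
      have "continuous_on UNIV z" using C that(1) homeo_groupD(2) unfolding central_series_def by blast
      then show ?thesis using that(2) prob_borel_distr by (simp add: prob_constrained_def)
    qed
    show "\<mu> \<in> prob_constrained {}" using \<mu>(1) by (simp add: prob_constrained_def)
  qed (auto simp: inv_prob_group_def)
  then obtain \<nu> where \<nu>: "\<nu> \<in> inv_prob_group G" by blast
  then have \<nu>K: "\<nu> \<in> inv_prob_group K" using KG by (auto simp: inv_prob_group_def)
  have "\<Gamma> 0 = G" using C by (simp add: central_series_def)
  then have "rotation_vector \<nu>1 F = rotation_vector \<nu> F" if "\<psi> \<in> H" "is_lift F \<psi>" for \<psi> F
    using rotation_vector_hyperbolic_unique[OF C a spec le0, folded K_def, OF \<nu>1 \<nu>K _ _ that(2)] that HK KG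
    by blast
  then show ?thesis using \<nu> r1 by metis
qed

text \<open>A Dehn twist group consists of the matrices \<open>P (1 0; k 1) P\<inverse>\<close>, which satisfy
  \<open>(x - 1)\<^sup>2 = 0\<close>.\<close>

lemma dehn_twist_group_unipotent:
  assumes D: "nontrivial_dehn_twist D" and x: "x \<in> generate GL2Z {D}"
  shows "x ** x + mat 1 = x + x"
proof -
  define T :: "int \<Rightarrow> int^2^2" where "T = (\<lambda>k. vector [vector [1, 0], vector [k, 1]])"
  obtain P m where P: "P \<in> carrier GL2Z" and Dm: "D = P \<otimes>\<^bsub>GL2Z\<^esub> T m \<otimes>\<^bsub>GL2Z\<^esub> inv\<^bsub>GL2Z\<^esub> P"
    using D unfolding nontrivial_dehn_twist_def T_def by blast
  define Q where "Q = inv\<^bsub>GL2Z\<^esub> P"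
  have PQ: "P ** Q = mat 1" and QP: "Q ** P = mat 1"
    using group.r_inv[OF group_GL2Z P] group.l_inv[OF group_GL2Z P] by (simp_all add: Q_def GL2Z_def)
  have TT: "T k ** T l = T (k + l)" for k l
    by (simp add: T_def vec_eq_iff forall_2 matrix_matrix_mult_def sum_2)
  have T0: "T 0 = mat 1" by (simp add: T_def vec_eq_iff forall_2 mat_def)
  have mult: "(P ** T k ** Q) ** (P ** T l ** Q) = P ** T (k + l) ** Q" for k l
  proof -
    have "(P ** T k ** Q) ** (P ** T l ** Q) = P ** (T k ** ((Q ** P) ** T l)) ** Q"
      by (simp only: matrix_mul_assoc)
    then show ?thesis by (simp add: QP TT)
  qed
  have one: "P ** T 0 ** Q = mat 1" by (simp add: T0 PQ)
  have carr: "P ** T k ** Q \<in> carrier GL2Z" for k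
    using mult[of k "- k"] mult[of "- k" k] one by (auto simp: GL2Z_def invertible_def)
  have "\<exists>k. x = P ** T k ** Q"
    using x
  proof (induction rule: generate.induct)
    case one
    then show ?case using \<open>P ** T 0 ** Q = mat 1\<close> by (auto simp: GL2Z_def intro: exI[of _ 0])
  next
    case (incl h)
    then show ?case using Dm by (auto simp: Q_def GL2Z_def)
  next
    case (inv h)
    then have "h = P ** T m ** Q" using Dm by (simp add: Q_def GL2Z_def)
    moreover have "inv\<^bsub>GL2Z\<^esub> (P ** T m ** Q) = P ** T (- m) ** Q"
      using mult[of "- m" m] one carr
      by (intro group.inv_equality[OF group_GL2Z]) (auto simp: GL2Z_def)
    ultimately show ?case by blast
  next
    case (eng g h)
    then show ?case using mult by (auto simp: GL2Z_def)
  qed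
  then obtain k where k: "x = P ** T k ** Q" by blast
  have dist: "P ** (B + C) ** Q = P ** B ** Q + P ** C ** Q" for B C
    by (simp add: vec_eq_iff matrix_matrix_mult_def distrib_left distrib_right sum.distrib)
  \<comment> \<open>\<open>T\<close> is affine in its parameter, and
    \<open>P ** T (k + k) ** Q\<close> is the square of \<open>x\<close>; conjugating this identity
    gives the claim.\<close>
  have "T (k + k) + T 0 = T k + T k" by (simp add: T_def vec_eq_iff forall_2)
  then have "P ** (T (k + k) + T 0) ** Q = P ** (T k + T k) ** Q" by simp
  then show ?thesis
    unfolding k mult by (simp only: dist one)
qed

theorem proposition4p6:
  fixes G :: "(torus \<Rightarrow> torus) set" and \<phi> :: "torus \<Rightarrow> torus" and \<mu> :: "torus measure"
  assumes subgroup: "subgroup G Homeo_torus"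
    and nilpotent: "nilpotent_group (Homeo_torus\<lparr>carrier := G\<rparr>)"
    and class_form:
      "mapping_class ` G = {mat 1} \<or>
       (\<exists>D. nontrivial_dehn_twist D \<and> mapping_class ` G = generate GL2Z {D}) \<or>
       (\<exists>A \<in> carrier GL2Z. (\<forall>c \<in> spec A. cmod c \<noteq> 1) \<and>
          (mapping_class ` G = generate GL2Z {A} \<or>
           mapping_class ` G = generate GL2Z {A, - mat 1}))"
    and \<phi>: "\<phi> \<in> isotopic_id_part G"
    and \<mu>: "\<mu> \<in> inv_prob \<phi>"
  shows "\<exists>\<nu> \<in> inv_prob_group G.
           (\<forall>F. is_lift F \<phi> \<longrightarrow> rotation_vector \<mu> F = rotation_vector \<nu> F) \<and>
           (\<mu> \<in> inv_prob_group (isotopic_id_part G) \<longrightarrow>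
              (\<forall>\<psi> \<in> isotopic_id_part G. \<forall>F. is_lift F \<psi> \<longrightarrow>
                 rotation_vector \<mu> F = rotation_vector \<nu> F))"
proof -
  obtain n where C: "central_series G (lower_central (Homeo_torus\<lparr>carrier := G\<rparr>)) n"
    using nilpotent_central_series[OF subgroup nilpotent] .
  \<comment> \<open>The case split is made in the choice of \<open>H\<close>, so that a single
    \<open>\<nu>\<close> serves both assertions; \<open>\<phi>\<close> lies in \<open>H\<close>
    either way.\<close>
  define H where "H = (if \<mu> \<in> inv_prob_group (isotopic_id_part G) then isotopic_id_part G else {\<phi>})"
  have \<phi>H: "\<phi> \<in> H" and H: "H \<subseteq> G" and \<mu>H: "\<mu> \<in> inv_prob_group H"
    using \<phi> \<mu> by (auto simp: H_def isotopic_id_part_def inv_prob_group_def)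
  have H1: "mapping_class \<psi> = mat 1" if "\<psi> \<in> H" for \<psi>
    using that \<phi> isotopic_id_mapping_class by (auto simp: H_def isotopic_id_part_def split: if_splits)
  have p: "prob_borel \<mu>" using \<mu> by (simp add: inv_prob_iff)
  have "\<exists>\<nu> \<in> inv_prob_group G. \<forall>\<psi>\<in>H. \<forall>F. is_lift F \<psi> \<longrightarrow> rotation_vector \<mu> F = rotation_vector \<nu> F"
    using class_form
  proof (elim disjE exE bexE conjE)
    assume "mapping_class ` G = {mat 1}"
    then have "mapping_class g = mat 1" if "g \<in> G" for g using that by blast
    then show ?thesis by (intro unipotent_extension[OF C H H1 _ p \<mu>H]) auto
  next
    fix D assume D: "nontrivial_dehn_twist D" "mapping_class ` G = generate GL2Z {D}"
    then have "mapping_class g ** mapping_class g + mat 1 = mapping_class g + mapping_class g"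
      if "g \<in> G" for g using that by (intro dehn_twist_group_unipotent) auto
    then show ?thesis by (intro unipotent_extension[OF C H H1 _ p \<mu>H])
  next
    fix A assume A: "\<forall>c \<in> spec A. cmod c \<noteq> 1" "mapping_class ` G = generate GL2Z {A}"
    \<comment> \<open>The generator is the class of some element of \<open>G\<close>, and that
      element is the one whose powers drive the two-sided orbit.\<close>
    then have "A \<in> mapping_class ` G" by (auto intro: generate.incl)
    then show ?thesis using hyperbolic_extension[OF C H H1 _ _ p \<mu>H] A(1) by blast
  next
    fix A assume A: "\<forall>c \<in> spec A. cmod c \<noteq> 1" "mapping_class ` G = generate GL2Z {A, - mat 1}"
    then have "A \<in> mapping_class ` G" by (auto intro: generate.incl)
    then show ?thesis using hyperbolic_extension[OF C H H1 _ _ p \<mu>H] A(1) by blast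
  qed
  then obtain \<nu> where \<nu>: "\<nu> \<in> inv_prob_group G"
    and rot: "\<And>\<psi> F. \<psi> \<in> H \<Longrightarrow> is_lift F \<psi> \<Longrightarrow> rotation_vector \<mu> F = rotation_vector \<nu> F"
    by blast
  show ?thesis
  proof (intro bexI[OF _ \<nu>] conjI allI impI ballI)
    show "rotation_vector \<mu> F = rotation_vector \<nu> F" if "is_lift F \<phi>" for F
      using rot[OF \<phi>H that] .
    show "rotation_vector \<mu> F = rotation_vector \<nu> F"
      if "\<mu> \<in> inv_prob_group (isotopic_id_part G)" "\<psi> \<in> isotopic_id_part G" "is_lift F \<psi>" for \<psi> F
      using rot[of \<psi> F] that by (simp add: H_def)
  qed
qed

end
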